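(* Assume that conditions (A1)-(A4) in the context hold. Let $\{x^k\}_{k\ge 0}$ and $\{\tilde x^k\}_{k\ge 1}$ be infinite sequences generated by Algorithm IR (defined in the context), with associated quantities $w^k$, $A_k$, $\sigma_k$, $\epsilon_k$, $\tilde u^{k+1}$. By the inequality $\mathrm{dist}(0,\,w^k\circ\partial\|\tilde x^{k+1}\|_1+A_k^TN_{\|\cdot\|^2\le\sigma_k}(\tilde u^{k+1}))\le\epsilon_k$, which the algorithm requires of the pair $(\tilde x^{k+1},\tilde u^{k+1})$, and the definition of the normal cone (noting $\sigma_k>0$), for each $k$ there exist $\xi^k\in\mathbb{R}^n$ with $\|\xi^k\|\le\epsilon_k$ and $\tilde\lambda_k\ge 0$ such that $$\xi^k\in w^k\circ\partial\|\tilde x^{k+1}\|_1+\tilde\lambda_kA_k^T\tilde u^{k+1}\quad\text{and}\quad \tilde\lambda_k(\|\tilde u^{k+1}\|^2-\sigma_k)=0 ;$$ let such $\xi^k$ and $\tilde\lambda_k$ be given for every $k$. Then the following statements hold. (i) $\liminf_{k\to\infty}\tilde\lambda_k>0$. (ii) $\lim_{k\to\infty}\phi'_+((b_i-a_i^Tx^k)^2)\,\big(a_i^T(\tilde x^{k+1}-x^k)\big)=0$ for all $i=1,\dots,m$. (iii) Every accumulation point $x^*$ of $\{x^k\}$ satisfies $\Phi((b-Ax^* )\circ(b-Ax^* ))=\sigma$. (iv) The sequence $\{\tilde\lambda_k\}$ is bounded. (v) Every accumulation point of $\{x^k\}$ is a stationary point of problem (P).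
   Context: Problem (P): minimize $\sum_{i=1}^n\psi(|x_i|)$ over $x\in\mathbb{R}^n$ subject to $\sum_{i=1}^m\phi((b_i-a_i^Tx)^2)\le\sigma$. Here $A\in\mathbb{R}^{m\times n}$ has $i$th row $a_i^T$, $b\in\mathbb{R}^m$ and $\sigma>0$. Assumptions: (A1) $\psi:\mathbb{R}_+\to\mathbb{R}_+$ is continuous and strictly concave with $\psi(0)=0$ and $\lim_{t\to\infty}\psi(t)=\infty$; it is differentiable on $(0,\infty)$ with $\psi'(t)>0$ for all $t>0$, and $\lim_{t\downarrow0}\psi'(t)$ exists and belongs to $(0,\infty)$. (A2) $\phi:\mathbb{R}_+\to\mathbb{R}_+$ is continuous and concave with $\phi(0)=0$; it is differentiable on $(0,\infty)$ with $\phi'(t)\ge0$ for all $t>0$, and $\lim_{t\downarrow0}\phi'(t)$ exists and belongs to $(0,\infty)$. (A3) $A$ has full row rank and $\sigma\in(0,\sum_{i=1}^m\phi(b_i^2))$. (A4) $\sigma\notin\{k\overline\phi: k=1,\dots,m\}$, where $\overline\phi:=\sup_{t\in\mathbb{R}_+}\phi(t)\in(0,\infty]$. Notation: $\psi'_+,\phi'_+:\mathbb{R}_+\to\mathbb{R}$ are the right-hand derivatives. For $u\in\mathbb{R}^n_+$, $v\in\mathbb{R}^m_+$: $\Psi(u)=\sum_{i=1}^n\psi(u_i)$, $\Phi(v)=\sum_{i=1}^m\phi(v_i)$, $\Psi'_+(u)=(\psi'_+(u_1),\dots,\psi'_+(u_n))$, $\Phi'_+(v)=(\phi'_+(v_1),\dots,\phi'_+(v_m))$.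 The feasible set is $\mathfrak{F}=\{x\in\mathbb{R}^n:\Phi((b-Ax)\circ(b-Ax))\le\sigma\}$. $\circ$ is the entrywise product, $|x|$ and $\sqrt{x}$ are taken entrywise, $\|\cdot\|$ is the Euclidean norm, $A^\dagger$ is the Moore-Penrose pseudoinverse. $\partial\|x\|_1$ is the convex subdifferential of the $\ell_1$ norm at $x$, and $w\circ\partial\|x\|_1=\{w\circ s:s\in\partial\|x\|_1\}$. $N_{\|\cdot\|^2\le\sigma_k}(u)$ is the normal cone at $u$ of the set $\{z\in\mathbb{R}^m:\|z\|^2\le\sigma_k\}$ (empty if $u$ is not in this set); the distance to the empty set is $+\infty$. Algorithm IR: Pick a positive sequence $\{\tau_k\}$ with $\tau_k\downarrow0$, a summable positive sequence $\{\mu_k\}$, and $x^0\in\mathfrak{F}$. For $k=0,1,2,\dots$: Step 1. Set $w^k=\Psi'_+(|x^k|)$, $y^k=b-Ax^k$, $v^k=\sqrt{\Phi'_+(y^k\circ y^k)}$, $A_k=\mathrm{Diag}(v^k)A$, $b^k=v^k\circ b$, $\sigma_k=\sigma+\|b^k-A_kx^k\|^2-\Phi(y^k\circ y^k)$. Step 2. Pick any $\epsilon_k\in(0,\min\{\sigma_k,\sqrt{\sigma_k},\tau_k\}]$ and approximately solve the subproblem $\min_x\|w^k\circ x\|_1$ s.t. $\|A_kx-b^k\|^2\le\sigma_k$ by finding a pair $(\tilde x^{k+1},\tilde u^{k+1})\in\mathbb{R}^n\times\mathbb{R}^m$ satisfying (C1) $\mathrm{dist}(0,\,w^k\circ\partial\|\tilde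 x^{k+1}\|_1+A_k^TN_{\|\cdot\|^2\le\sigma_k}(\tilde u^{k+1}))\le\epsilon_k$, (C2) $\|A_k\tilde x^{k+1}-b^k-\tilde u^{k+1}\|\le\epsilon_k$, (C3) $\|w^k\circ P_k(\tilde x^{k+1})\|_1\le\|w^k\circ x^k\|_1+\mu_k$, where $P_k(x)=x$ if $\|A_kx-b^k\|^2\le\sigma_k$, and otherwise $P_k(x)=\left(1-\frac{\sqrt{\sigma_k}}{\|A_kx-b^k\|}\right)A^\dagger b+\frac{\sqrt{\sigma_k}}{\|A_kx-b^k\|}x$. Step 3. Set $x^{k+1}=P_k(\tilde x^{k+1})$. Stationary point: $x\in\mathbb{R}^n$ is a stationary point of (P) if there exists $\lambda\ge0$ such that $\lambda(\Phi((b-Ax)\circ(b-Ax))-\sigma)=0$, $\Phi((b-Ax)\circ(b-Ax))\le\sigma$, and $0\in\Psi'_+(|x|)\circ\partial\|x\|_1-2\lambda\sum_{i=1}^m\phi'_+((b_i-a_i^Tx)^2)(b_i-a_i^Tx)a_i$. *)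

theory Defs
  imports "HOL-Analysis.Analysis"
begin

text \<open>
  Vectors are elements of \<open>real ^ 'n\<close> and \<open>real ^ 'm\<close>, matrices of \<open>real ^ 'n ^ 'm\<close>.
  On vectors, the library's \<open>u * v\<close> is the entrywise product and \<open>\<bar>u\<bar>\<close> the entrywise absolute
  value. A function on the nonnegative reals is a function \<open>real \<Rightarrow> real\<close> of which only the
  values on \<open>{0..}\<close> are used.
\<close>

section \<open>Notions from convex analysis and linear algebra\<close>

definition strictly_concave_on :: "real set \<Rightarrow> (real \<Rightarrow> real) \<Rightarrow> bool" where
  "strictly_concave_on S f \<longleftrightarrow> convex S \<and>
     (\<forall>x\<in>S. \<forall>y\<in>S. \<forall>u>0. \<forall>v>0. x \<noteq> y \<and> u + v = 1 \<longrightarrow>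
        f (u * x + v * y) > u * f x + v * f y)"

definition right_deriv :: "(real \<Rightarrow> real) \<Rightarrow> real \<Rightarrow> real" where
  "right_deriv f t = (THE D. (f has_real_derivative D) (at_right t))"

definition subdifferential :: "('a::real_inner \<Rightarrow> real) \<Rightarrow> 'a \<Rightarrow> 'a set" where
  "subdifferential f x = {s. \<forall>y. f y \<ge> f x + s \<bullet> (y - x)}"

definition normal_cone :: "'a::real_inner set \<Rightarrow> 'a \<Rightarrow> 'a set" where
  "normal_cone S u = (if u \<in> S then {v. \<forall>z\<in>S. v \<bullet> (z - u) \<le> 0} else {})"

text \<open>Unlike \<open>infdist\<close>, this distance is \<open>\<infinity>\<close> for the empty set.\<close>

definition edist_set :: "'a::metric_space \<Rightarrow> 'a set \<Rightarrow> ereal" where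
  "edist_set p S = (INF q\<in>S. ereal (dist p q))"

definition l1_norm :: "real ^ 'n \<Rightarrow> real" where
  "l1_norm x = (\<Sum>i\<in>UNIV. \<bar>x $ i\<bar>)"

definition diag :: "real ^ 'm \<Rightarrow> real ^ 'm ^ 'm" where
  "diag v = (\<chi> i j. if i = j then v $ i else 0)"

definition is_pseudoinverse :: "real ^ 'n ^ 'm \<Rightarrow> real ^ 'm ^ 'n \<Rightarrow> bool" where
  "is_pseudoinverse A X \<longleftrightarrow>
     A ** X ** A = A \<and> X ** A ** X = X \<and>
     transpose (A ** X) = A ** X \<and> transpose (X ** A) = X ** A"

definition pseudoinverse :: "real ^ 'n ^ 'm \<Rightarrow> real ^ 'm ^ 'n" where
  "pseudoinverse A = (THE X. is_pseudoinverse A X)"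

definition accumulation_point :: "(nat \<Rightarrow> 'a::topological_space) \<Rightarrow> 'a \<Rightarrow> bool" where
  "accumulation_point X p \<longleftrightarrow> (\<exists>r. strict_mono r \<and> (X \<circ> r) \<longlonglongrightarrow> p)"

section \<open>The problem\<close>

text \<open>\<open>sep_sum \<psi>\<close> is \<open>\<Psi>\<close> and \<open>sep_sum \<phi>\<close> is \<open>\<Phi>\<close>; \<open>sep_right_deriv\<close> gives \<open>\<Psi>'\<^sub>+\<close> and \<open>\<Phi>'\<^sub>+\<close>.\<close>

definition sep_sum :: "(real \<Rightarrow> real) \<Rightarrow> real ^ 'n \<Rightarrow> real" where
  "sep_sum f u = (\<Sum>i\<in>UNIV. f (u $ i))"

definition sep_right_deriv :: "(real \<Rightarrow> real) \<Rightarrow> real ^ 'n \<Rightarrow> real ^ 'n" where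
  "sep_right_deriv f u = (\<chi> i. right_deriv f (u $ i))"

definition cond_A1 :: "(real \<Rightarrow> real) \<Rightarrow> bool" where
  "cond_A1 \<psi> \<longleftrightarrow>
     (\<forall>t\<ge>0. \<psi> t \<ge> 0) \<and> continuous_on {0..} \<psi> \<and> strictly_concave_on {0..} \<psi> \<and>
     \<psi> 0 = 0 \<and> filterlim \<psi> at_top at_top \<and>
     (\<forall>t>0. \<psi> differentiable (at t) \<and> deriv \<psi> t > 0) \<and>
     (\<exists>L>0. (deriv \<psi> \<longlongrightarrow> L) (at_right 0))"

definition cond_A2 :: "(real \<Rightarrow> real) \<Rightarrow> bool" where
  "cond_A2 \<phi> \<longleftrightarrow>
     (\<forall>t\<ge>0. \<phi> t \<ge> 0) \<and> continuous_on {0..} \<phi> \<and> concave_on {0..} \<phi> \<and>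
     \<phi> 0 = 0 \<and>
     (\<forall>t>0. \<phi> differentiable (at t) \<and> deriv \<phi> t \<ge> 0) \<and>
     (\<exists>L>0. (deriv \<phi> \<longlongrightarrow> L) (at_right 0))"

definition cond_A3 :: "(real \<Rightarrow> real) \<Rightarrow> real ^ 'n ^ 'm \<Rightarrow> real ^ 'm \<Rightarrow> real \<Rightarrow> bool" where
  "cond_A3 \<phi> A b \<sigma> \<longleftrightarrow>
     rank A = CARD('m) \<and> 0 < \<sigma> \<and> \<sigma> < (\<Sum>i\<in>UNIV. \<phi> ((b $ i)\<^sup>2))"

definition phi_sup :: "(real \<Rightarrow> real) \<Rightarrow> ereal" where
  "phi_sup \<phi> = (SUP t\<in>{0..}. ereal (\<phi> t))"

definition cond_A4 :: "(real \<Rightarrow> real) \<Rightarrow> real \<Rightarrow> nat \<Rightarrow> bool" where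
  "cond_A4 \<phi> \<sigma> m \<longleftrightarrow> ereal \<sigma> \<notin> (\<lambda>k. ereal (real k) * phi_sup \<phi>) ` {1..m}"

definition constraint_fun :: "(real \<Rightarrow> real) \<Rightarrow> real ^ 'n ^ 'm \<Rightarrow> real ^ 'm \<Rightarrow> real ^ 'n \<Rightarrow> real" where
  "constraint_fun \<phi> A b x = sep_sum \<phi> ((b - A *v x) * (b - A *v x))"

definition feasible_set ::
    "(real \<Rightarrow> real) \<Rightarrow> real ^ 'n ^ 'm \<Rightarrow> real ^ 'm \<Rightarrow> real \<Rightarrow> (real ^ 'n) set" where
  "feasible_set \<phi> A b \<sigma> = {x. constraint_fun \<phi> A b x \<le> \<sigma>}"

definition stationary_point ::
    "(real \<Rightarrow> real) \<Rightarrow> (real \<Rightarrow> real) \<Rightarrow> real ^ 'n ^ 'm \<Rightarrow> real ^ 'm \<Rightarrow> real \<Rightarrow> real ^ 'n \<Rightarrow> bool" where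
  "stationary_point \<psi> \<phi> A b \<sigma> x \<longleftrightarrow>
     (\<exists>l\<ge>0. l * (constraint_fun \<phi> A b x - \<sigma>) = 0 \<and> constraint_fun \<phi> A b x \<le> \<sigma> \<and>
        0 \<in> (\<lambda>s. sep_right_deriv \<psi> \<bar>x\<bar> * s) ` subdifferential l1_norm x
          + {- ((2 * l) *\<^sub>R (\<Sum>i\<in>UNIV.
                (right_deriv \<phi> ((b $ i - row i A \<bullet> x)\<^sup>2) * (b $ i - row i A \<bullet> x)) *\<^sub>R row i A))})"

section \<open>The algorithm\<close>

text \<open>The quantities \<open>w\<^sup>k\<close>, \<open>y\<^sup>k\<close>, \<open>v\<^sup>k\<close>, \<open>A\<^sub>k\<close>, \<open>b\<^sup>k\<close>, \<open>\<sigma>\<^sub>k\<close> as functions of the current iterate \<open>x\<close>.\<close>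

definition IR_w :: "(real \<Rightarrow> real) \<Rightarrow> real ^ 'n \<Rightarrow> real ^ 'n" where
  "IR_w \<psi> x = sep_right_deriv \<psi> \<bar>x\<bar>"

definition IR_y :: "real ^ 'n ^ 'm \<Rightarrow> real ^ 'm \<Rightarrow> real ^ 'n \<Rightarrow> real ^ 'm" where
  "IR_y A b x = b - A *v x"

definition IR_v :: "(real \<Rightarrow> real) \<Rightarrow> real ^ 'n ^ 'm \<Rightarrow> real ^ 'm \<Rightarrow> real ^ 'n \<Rightarrow> real ^ 'm" where
  "IR_v \<phi> A b x = (\<chi> i. sqrt (sep_right_deriv \<phi> (IR_y A b x * IR_y A b x) $ i))"

definition IR_A :: "(real \<Rightarrow> real) \<Rightarrow> real ^ 'n ^ 'm \<Rightarrow> real ^ 'm \<Rightarrow> real ^ 'n \<Rightarrow> real ^ 'n ^ 'm" where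
  "IR_A \<phi> A b x = diag (IR_v \<phi> A b x) ** A"

definition IR_b :: "(real \<Rightarrow> real) \<Rightarrow> real ^ 'n ^ 'm \<Rightarrow> real ^ 'm \<Rightarrow> real ^ 'n \<Rightarrow> real ^ 'm" where
  "IR_b \<phi> A b x = IR_v \<phi> A b x * b"

definition IR_sigma :: "(real \<Rightarrow> real) \<Rightarrow> real ^ 'n ^ 'm \<Rightarrow> real ^ 'm \<Rightarrow> real \<Rightarrow> real ^ 'n \<Rightarrow> real" where
  "IR_sigma \<phi> A b \<sigma> x =
     \<sigma> + (norm (IR_b \<phi> A b x - IR_A \<phi> A b x *v x))\<^sup>2 - sep_sum \<phi> (IR_y A b x * IR_y A b x)"

text \<open>\<open>IR_P \<phi> A b \<sigma> x\<close> is the map \<open>P\<^sub>k\<close> for the current iterate \<open>x\<close>.\<close>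

definition IR_P ::
    "(real \<Rightarrow> real) \<Rightarrow> real ^ 'n ^ 'm \<Rightarrow> real ^ 'm \<Rightarrow> real \<Rightarrow> real ^ 'n \<Rightarrow> real ^ 'n \<Rightarrow> real ^ 'n" where
  "IR_P \<phi> A b \<sigma> x z =
     (let r = norm (IR_A \<phi> A b x *v z - IR_b \<phi> A b x); s = IR_sigma \<phi> A b \<sigma> x in
      if r\<^sup>2 \<le> s then z
      else (1 - sqrt s / r) *\<^sub>R (pseudoinverse A *v b) + (sqrt s / r) *\<^sub>R z)"

text \<open>
  \<open>IR_step \<psi> \<phi> A b \<sigma> \<mu> \<epsilon> x xt ut\<close>: from the iterate \<open>x\<close>, the pair \<open>(xt, ut)\<close> is accepted as an
  approximate solution of the subproblem with tolerances \<open>\<epsilon>\<close> and \<open>\<mu>\<close>.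
\<close>

definition IR_step ::
    "(real \<Rightarrow> real) \<Rightarrow> (real \<Rightarrow> real) \<Rightarrow> real ^ 'n ^ 'm \<Rightarrow> real ^ 'm \<Rightarrow> real \<Rightarrow> real \<Rightarrow> real \<Rightarrow>
     real ^ 'n \<Rightarrow> real ^ 'n \<Rightarrow> real ^ 'm \<Rightarrow> bool" where
  "IR_step \<psi> \<phi> A b \<sigma> \<mu> \<epsilon> x xt ut \<longleftrightarrow>
     edist_set 0
       ((\<lambda>s. IR_w \<psi> x * s) ` subdifferential l1_norm xt
        + (\<lambda>v. transpose (IR_A \<phi> A b x) *v v) `
            normal_cone {z. (norm z)\<^sup>2 \<le> IR_sigma \<phi> A b \<sigma> x} ut) \<le> ereal \<epsilon> \<and>
     norm (IR_A \<phi> A b x *v xt - IR_b \<phi> A b x - ut) \<le> \<epsilon> \<and>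
     l1_norm (IR_w \<psi> x * IR_P \<phi> A b \<sigma> x xt) \<le> l1_norm (IR_w \<psi> x * x) + \<mu>"

text \<open>
  The approximate solution computed from the \<open>k\<close>-th iterate \<open>x k\<close> is \<open>(xt (Suc k), ut (Suc k))\<close>;
  \<open>xt 0\<close> and \<open>ut 0\<close> are unused.
\<close>

definition IR_sequence ::
    "(real \<Rightarrow> real) \<Rightarrow> (real \<Rightarrow> real) \<Rightarrow> real ^ 'n ^ 'm \<Rightarrow> real ^ 'm \<Rightarrow> real \<Rightarrow>
     (nat \<Rightarrow> real) \<Rightarrow> (nat \<Rightarrow> real) \<Rightarrow> (nat \<Rightarrow> real) \<Rightarrow>
     (nat \<Rightarrow> real ^ 'n) \<Rightarrow> (nat \<Rightarrow> real ^ 'n) \<Rightarrow> (nat \<Rightarrow> real ^ 'm) \<Rightarrow> bool" where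
  "IR_sequence \<psi> \<phi> A b \<sigma> \<tau> \<mu> \<epsilon> x xt ut \<longleftrightarrow>
     (\<forall>k. \<tau> k > 0) \<and> decseq \<tau> \<and> \<tau> \<longlonglongrightarrow> 0 \<and>
     (\<forall>k. \<mu> k > 0) \<and> summable \<mu> \<and>
     x 0 \<in> feasible_set \<phi> A b \<sigma> \<and>
     (\<forall>k. \<epsilon> k > 0 \<and>
          \<epsilon> k \<le> Min {IR_sigma \<phi> A b \<sigma> (x k), sqrt (IR_sigma \<phi> A b \<sigma> (x k)), \<tau> k} \<and>
          IR_step \<psi> \<phi> A b \<sigma> (\<mu> k) (\<epsilon> k) (x k) (xt (Suc k)) (ut (Suc k)) \<and>
          x (Suc k) = IR_P \<phi> A b \<sigma> (x k) (xt (Suc k)))"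

text \<open>
  The distance condition of \<open>IR_step\<close> with the normal cone of the ball resolved: \<open>\<xi>\<close> is the
  residual and \<open>l\<close> the multiplier of the subproblem's constraint.
\<close>

definition IR_multiplier ::
    "(real \<Rightarrow> real) \<Rightarrow> (real \<Rightarrow> real) \<Rightarrow> real ^ 'n ^ 'm \<Rightarrow> real ^ 'm \<Rightarrow> real \<Rightarrow> real \<Rightarrow>
     real ^ 'n \<Rightarrow> real ^ 'n \<Rightarrow> real ^ 'm \<Rightarrow> real ^ 'n \<Rightarrow> real \<Rightarrow> bool" where
  "IR_multiplier \<psi> \<phi> A b \<sigma> \<epsilon> x xt ut \<xi> l \<longleftrightarrow>
     norm \<xi> \<le> \<epsilon> \<and> l \<ge> 0 \<and>
     \<xi> \<in> (\<lambda>s. IR_w \<psi> x * s) ` subdifferential l1_norm xt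
         + {l *\<^sub>R (transpose (IR_A \<phi> A b x) *v ut)} \<and>
     l * ((norm ut)\<^sup>2 - IR_sigma \<phi> A b \<sigma> x) = 0"

end

theory Submission
  imports Defs
begin

text \<open>
  Concavity of \<open>\<phi>\<close> makes the ball constraint of the subproblem a majorant of \<open>\<Phi> \<le> \<sigma>\<close> that is
  tight at \<open>x\<^sup>k\<close>, so all iterates are feasible, and (A4) together with compactness keeps
  \<open>\<sigma>\<^sub>k\<close> away from \<open>0\<close>. Concavity of \<open>\<psi>\<close> makes \<open>\<Psi>(\<bar>x\<^sup>k\<bar>)\<close> decreasing up to
  summable errors; hence the iterates are bounded and the weighted \<open>\<ell>\<^sub>1\<close> decrease of a step tends to
  \<open>0\<close>. Multipliers cannot tend to \<open>0\<close>, since that would drive \<open>x\<close> to the infeasible point \<open>0\<close>.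
  The subgradient inequality between \<open>x\<^sup>k\<close> and the approximate solution then forces
  \<open>A\<^sub>k x\<^sup>k - b\<^sup>k - u\<close> to vanish in the limit; with complementarity this gives the active constraint,
  boundedness of the multipliers and, passing to the limit along a subsequence, stationarity.
\<close>

section \<open>One-sided derivatives of concave functions\<close>

lemma right_deriv_eqI:
  assumes "(f has_real_derivative D) (at_right t)"
  shows "right_deriv f t = D"
  unfolding right_deriv_def
proof (rule the_equality)
  fix E assume "(f has_real_derivative E) (at_right t)"
  with assms show "E = D"
    by (auto simp: has_field_derivative_iff intro: tendsto_unique[rotated])
qed (rule assms)

lemma strictly_concave_on_imp_concave_on:
  assumes "strictly_concave_on S f"
  shows "concave_on S f"
proof -
  have "u * f x + v * f y \<le> f (u * x + v * y)"
    if "x \<in> S" "y \<in> S" "u \<ge> 0" "v \<ge> 0" "u + v = 1" for x y u v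
  proof (cases "x = y \<or> u = 0 \<or> v = 0")
    case True
    with \<open>u + v = 1\<close> show ?thesis
      by (auto simp flip: distrib_right)
  next
    case False
    then show ?thesis
      using assms that unfolding strictly_concave_on_def by (intro less_imp_le) auto
  qed
  then show ?thesis
    using assms by (auto simp: concave_on_iff strictly_concave_on_def)
qed

text \<open>Collects what \<open>\<psi>\<close> and \<open>\<phi>\<close> have in common. The limit
  \<open>L\<close> of the derivative at the origin turns out to be the right derivative there, so
  both are later instantiated with \<open>right_deriv\<close> at \<open>0\<close>.\<close>

locale concave_penalty =
  fixes f :: "real \<Rightarrow> real" and L :: real
  assumes cont: "continuous_on {0..} f"
    and conc: "concave_on {0..} f"
    and zero: "f 0 = 0"
    and diff: "\<And>t. t > 0 \<Longrightarrow> f differentiable (at t)"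
    and lim: "(deriv f \<longlongrightarrow> L) (at_right 0)"
begin

lemma DERIV_deriv: "t > 0 \<Longrightarrow> (f has_real_derivative deriv f t) (at t)"
  using diff DERIV_deriv_iff_real_differentiable by blast

lemma right_deriv_pos: "t > 0 \<Longrightarrow> right_deriv f t = deriv f t"
  by (rule right_deriv_eqI, rule has_field_derivative_at_within, rule DERIV_deriv)

lemma tendsto_at_right_0: "(f \<longlongrightarrow> 0) (at_right 0)"
  using cont zero unfolding continuous_on_def
  by (metis atLeast_iff at_within_Ici_at_right order_refl)

text \<open>Since \<open>f 0 = 0\<close>, the difference quotient at the origin is
  \<open>f x / x\<close>, and L'Hopital's rule carries the limit of the derivative over to
  it.\<close>

lemma right_deriv_0: "right_deriv f 0 = L"
proof (rule right_deriv_eqI)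
  have "((\<lambda>x. f x / x) \<longlongrightarrow> L) (at_right 0)"
  proof (rule lhopital_right_0)
    show "\<forall>\<^sub>F x in at_right 0. (f has_real_derivative deriv f x) (at x)"
      using eventually_at_right_less by eventually_elim (rule DERIV_deriv)
    show "\<forall>\<^sub>F x in at_right 0. ((\<lambda>x. x) has_real_derivative 1) (at x)"
      by simp
    show "\<forall>\<^sub>F x in at_right 0. x \<noteq> (0::real)"
      using eventually_at_right_less[of "0::real"] by eventually_elim simp
  qed (use tendsto_at_right_0 lim in \<open>simp_all add: tendsto_ident_at\<close>)
  then show "(f has_real_derivative L) (at_right 0)"
    by (simp add: has_field_derivative_iff zero)
qed

section \<open>Tangents of a concave function and continuity of its derivative\<close>

lemma tangent_pos:
  assumes "t > 0" "s \<ge> 0"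
  shows "f s \<le> f t + deriv f t * (s - t)"
proof -
  have "- f s - - f t \<ge> - deriv f t * (s - t)"
  proof (rule convex_on_imp_above_tangent[where A = "{0..}"])
    show "convex_on {0..} (\<lambda>x. - f x)"
      using conc by (simp add: concave_on_def)
    show "((\<lambda>x. - f x) has_real_derivative - deriv f t) (at t within {0..})"
      using has_field_derivative_at_within[OF DERIV_minus[OF DERIV_deriv[OF assms(1)]]] .
  qed (use assms in auto)
  then show ?thesis by simp
qed

lemma tangent:
  assumes "t \<ge> 0" "s \<ge> 0"
  shows "f s \<le> f t + right_deriv f t * (s - t)"
proof (cases "t = 0")
  case False
  then show ?thesis using tangent_pos assms by (simp add: right_deriv_pos)
next
  case True
  \<comment> \<open>At the origin the inequality is the limit of the tangent inequalities at
    \<open>t > 0\<close>.\<close>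
  have "f s \<le> 0 + L * (s - 0)"
  proof (rule tendsto_lowerbound)
    show "((\<lambda>t. f t + deriv f t * (s - t)) \<longlongrightarrow> 0 + L * (s - 0)) (at_right 0)"
      by (intro tendsto_intros tendsto_at_right_0 lim)
    show "\<forall>\<^sub>F t in at_right 0. f s \<le> f t + deriv f t * (s - t)"
      using eventually_at_right_less by eventually_elim (rule tangent_pos[OF _ assms(2)])
  qed simp
  with True show ?thesis by (simp add: right_deriv_0 zero)
qed

text \<open>At \<open>t > 0\<close>, the tangent inequality at \<open>s\<close> squeezes the derivative at \<open>s\<close> between difference
  quotients with the fixed end points \<open>t + h\<close> on both sides of \<open>t\<close>.\<close>

lemma isCont_deriv:
  assumes "t > 0"
  shows "isCont (deriv f) t"
proof -
  define q where "q = (\<lambda>h s. (f (t + h) - f s) / (t + h - s))"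
  have fs: "isCont f t"
    using DERIV_deriv[OF assms] by (rule DERIV_isCont)
  have q0: "((\<lambda>h. q h t) \<longlongrightarrow> deriv f t) (at 0)"
    using DERIV_deriv[OF assms] by (simp add: DERIV_def q_def)
  have qlim: "(q h \<longlongrightarrow> q h t) (at t)" if "h \<noteq> 0" for h
  proof -
    have "isCont (\<lambda>s. (f (t + h) - f s) / (t + h - s)) t"
      using that by (intro continuous_divide continuous_diff continuous_const continuous_ident fs) auto
    then show ?thesis by (simp add: q_def isCont_def)
  qed
  have ev: "\<forall>\<^sub>F s in at t. s > 0"
    by (rule order_tendstoD(1)[OF tendsto_ident_at assms])
  show ?thesis
    unfolding isCont_def
  proof (rule order_tendstoI)
    fix a assume "a < deriv f t"
    from order_tendstoD(1)[OF filterlim_mono[OF q0 order_refl, of "at_right 0"] this]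
    have "\<forall>\<^sub>F h in at_right 0. a < q h t" by (simp add: at_le)
    moreover have "\<forall>\<^sub>F h in at_right 0. h > (0::real)" by (rule eventually_at_right_less)
    ultimately have "\<forall>\<^sub>F h in at_right 0. h > 0 \<and> a < q h t" by eventually_elim simp
    then obtain h where h: "h > 0" "a < q h t"
      using eventually_happens'[OF trivial_limit_at_right_real] by blast
    have "\<forall>\<^sub>F s in at t. s < t + h"
      using h by (intro order_tendstoD(2)[OF tendsto_ident_at]) auto
    moreover have "\<forall>\<^sub>F s in at t. a < q h s"
      using h by (intro order_tendstoD(1)[OF qlim]) auto
    ultimately show "\<forall>\<^sub>F s in at t. a < deriv f s"
      using ev
    proof eventually_elim
      case (elim s)
      have "f (t + h) - f s \<le> deriv f s * (t + h - s)"
        using tangent_pos[of s "t + h"] elim h assms by simp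
      then have "q h s \<le> deriv f s"
        using elim by (simp add: q_def pos_divide_le_eq)
      with elim show ?case by simp
    qed
  next
    fix a assume "deriv f t < a"
    from order_tendstoD(2)[OF filterlim_mono[OF q0 order_refl, of "at_left 0"] this]
    have "\<forall>\<^sub>F h in at_left 0. q h t < a" by (simp add: at_le)
    moreover have "\<forall>\<^sub>F h in at_left 0. h < (0::real) \<and> - t < h"
      using assms by (intro eventually_at_leftI[of "-t"]) auto
    ultimately have "\<forall>\<^sub>F h in at_left 0. h < 0 \<and> - t < h \<and> q h t < a" by eventually_elim simp
    then obtain h where h: "h < 0" "- t < h" "q h t < a"
      using eventually_happens'[OF trivial_limit_at_left_real] by blast
    have "\<forall>\<^sub>F s in at t. t + h < s"
      using h by (intro order_tendstoD(1)[OF tendsto_ident_at]) auto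
    moreover have "\<forall>\<^sub>F s in at t. q h s < a"
      using h by (intro order_tendstoD(2)[OF qlim]) auto
    ultimately show "\<forall>\<^sub>F s in at t. deriv f s < a"
      using ev
    proof eventually_elim
      case (elim s)
      have "f (t + h) - f s \<le> deriv f s * (t + h - s)"
        using tangent_pos[of s "t + h"] elim h assms by simp
      then have "deriv f s \<le> q h s"
        using elim by (simp add: q_def neg_le_divide_eq)
      with elim show ?case by simp
    qed
  qed
qed

text \<open>At positive points the right derivative is the ordinary derivative, which is continuous;
  at the origin continuity is the limit \<open>lim\<close>.\<close>

lemma continuous_on_right_deriv: "continuous_on {0..} (right_deriv f)"
  unfolding continuous_on_def
proof
  fix t :: real assume "t \<in> {0..}"
  have ev: "\<forall>\<^sub>F s in at_right t. deriv f s = right_deriv f s" if "t \<ge> 0" for t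
    using eventually_at_right_less by eventually_elim (use that in \<open>simp add: right_deriv_pos\<close>)
  consider "t = 0" | "t > 0" using \<open>t \<in> {0..}\<close> by fastforce
  then show "(right_deriv f \<longlongrightarrow> right_deriv f t) (at t within {0..})"
  proof cases
    case 1
    have "(right_deriv f \<longlongrightarrow> L) (at_right 0)"
      using lim by (rule Lim_transform_eventually) (rule ev, simp)
    with 1 show ?thesis
      by (simp add: right_deriv_0 at_within_Ici_at_right)
  next
    case 2
    have "\<forall>\<^sub>F s in at t. s > 0"
      by (rule order_tendstoD(1)[OF tendsto_ident_at 2])
    then have "\<forall>\<^sub>F s in at t. deriv f s = right_deriv f s"
      by eventually_elim (simp add: right_deriv_pos)
    then have "(right_deriv f \<longlongrightarrow> right_deriv f t) (at t)"
      using isCont_deriv[OF 2] 2 unfolding isCont_def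
      by (metis Lim_transform_eventually right_deriv_pos)
    then show ?thesis
      by (rule filterlim_mono[OF _ order_refl]) (simp add: at_le)
  qed
qed

end

section \<open>Pseudoinverses, subdifferentials and normal cones\<close>

text \<open>Penrose's argument: the symmetry conditions give \<open>A ** X = A ** Y\<close>; the
  same fact for the transposes gives \<open>X ** A = Y ** A\<close>; then
  \<open>X = X ** A ** X = Y ** A ** Y = Y\<close>.\<close>

lemma is_pseudoinverse_unique:
  assumes X: "is_pseudoinverse A X" and Y: "is_pseudoinverse A Y"
  shows "X = Y"
proof -
  have *: "A ** X = A ** Y" if "is_pseudoinverse A X" "is_pseudoinverse A Y"
    for A :: "real ^ 'i ^ 'j" and X Y
  proof -
    have "A ** X = transpose (A ** Y ** (A ** X))"
      using that by (simp add: is_pseudoinverse_def matrix_mul_assoc)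
    also have "\<dots> = (A ** X) ** (A ** Y)"
      using that by (simp add: matrix_transpose_mul[of "A ** Y"] is_pseudoinverse_def)
    also have "\<dots> = A ** Y"
      using that by (simp add: is_pseudoinverse_def matrix_mul_assoc)
    finally show ?thesis .
  qed
  have tr: "is_pseudoinverse (transpose A) (transpose Z)" if "is_pseudoinverse A Z" for Z
    using that unfolding is_pseudoinverse_def
    by (metis matrix_mul_assoc matrix_transpose_mul)
  have "transpose A ** transpose X = transpose A ** transpose Y"
    using X Y by (intro * tr)
  then have XY: "X ** A = Y ** A"
    by (metis matrix_transpose_mul transpose_transpose)
  have "X = X ** (A ** X)"
    using X by (simp add: is_pseudoinverse_def matrix_mul_assoc)
  also have "\<dots> = Y ** A ** Y"
    using *[OF X Y] XY by (simp add: matrix_mul_assoc)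
  also have "\<dots> = Y"
    using Y by (simp add: is_pseudoinverse_def)
  finally show ?thesis .
qed

lemma pseudoinverse_eqI: "is_pseudoinverse A X \<Longrightarrow> pseudoinverse A = X"
  unfolding pseudoinverse_def using is_pseudoinverse_unique by blast

text \<open>Full row rank makes the Gram matrix \<open>A ** transpose A\<close> invertible. With
  \<open>B\<close> its inverse, \<open>transpose A ** B\<close> satisfies the four Penrose equations
  and is a right inverse of \<open>A\<close>.\<close>

lemma full_row_rank_pseudoinverse:
  fixes A :: "real ^ 'n ^ 'm"
  assumes "rank A = CARD('m)"
  shows "A *v (pseudoinverse A *v b) = b"
proof -
  let ?G = "A ** transpose A"
  have inj: "inj ((*v) (transpose A))"
    using assms by (simp add: full_rank_injective[symmetric] rank_transpose)
  have "z = 0" if "?G *v z = 0" for z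
  proof -
    have "(transpose A *v z) \<bullet> (transpose A *v z) = z \<bullet> (?G *v z)"
      by (simp add: dot_lmul_matrix matrix_vector_mul_assoc[symmetric])
    with that have "transpose A *v z = transpose A *v 0" by simp
    with inj show ?thesis by (meson injD)
  qed
  then obtain B where B: "B ** ?G = mat 1" "?G ** B = mat 1"
    by (metis matrix_left_invertible_ker matrix_left_right_inverse)
  have "transpose ?G = ?G" by (simp add: matrix_transpose_mul)
  then have "transpose B ** ?G = mat 1"
    by (metis B(2) matrix_transpose_mul transpose_mat)
  then have tB: "transpose B = B"
    by (metis B(2) matrix_mul_assoc matrix_mul_lid matrix_mul_rid)
  have AX: "A ** (transpose A ** B) = mat 1"
    using B by (simp add: matrix_mul_assoc)
  have "is_pseudoinverse A (transpose A ** B)"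
    unfolding is_pseudoinverse_def
  proof (intro conjI)
    show "transpose A ** B ** A ** (transpose A ** B) = transpose A ** B"
      by (metis AX matrix_mul_assoc matrix_mul_rid)
    show "transpose (transpose A ** B ** A) = transpose A ** B ** A"
      by (simp add: matrix_transpose_mul tB matrix_mul_assoc)
  qed (simp_all add: AX transpose_mat)
  from pseudoinverse_eqI[OF this] show ?thesis
    by (simp only: matrix_vector_mul_assoc AX matrix_vector_mul_lid)
qed

section \<open>The subdifferential of the l1 norm and the normal cone of a ball\<close>

lemma subdifferential_l1_norm:
  "subdifferential l1_norm (x :: real ^ 'n) = {s. \<forall>i. \<bar>s $ i\<bar> \<le> 1 \<and> s $ i * x $ i = \<bar>x $ i\<bar>}"
proof (intro set_eqI iffI)
  fix s assume s: "s \<in> subdifferential l1_norm x"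
  have "\<bar>s $ i\<bar> \<le> 1 \<and> s $ i * x $ i = \<bar>x $ i\<bar>" for i
  proof -
    \<comment> \<open>Testing with a point that differs from \<open>x\<close> in entry
      \<open>i\<close> only reduces the subgradient inequality to one dimension. There
      \<open>r = 0\<close> and \<open>r = 2 * x $ i\<close> give the equation, \<open>r = 1\<close>
      and \<open>r = -1\<close> the bound on \<open>s $ i\<close>.\<close>
    have *: "\<bar>x $ i\<bar> + s $ i * (r - x $ i) \<le> \<bar>r\<bar>" for r
    proof -
      define y where "y = (\<chi> j. if j = i then r else x $ j)"
      have "l1_norm x + s \<bullet> (y - x) \<le> l1_norm y"
        using s by (simp add: subdifferential_def)
      moreover have "s \<bullet> (y - x) = (\<Sum>j\<in>UNIV. if j = i then s $ i * (r - x $ i) else 0)"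
        unfolding inner_vec_def by (rule sum.cong) (auto simp: y_def)
      moreover have "l1_norm y - l1_norm x = (\<Sum>j\<in>UNIV. if j = i then \<bar>r\<bar> - \<bar>x $ i\<bar> else 0)"
        unfolding l1_norm_def sum_subtractf[symmetric] by (rule sum.cong) (auto simp: y_def)
      ultimately show ?thesis by simp
    qed
    have sx: "s $ i * x $ i = \<bar>x $ i\<bar>"
      using *[of 0] *[of "2 * x $ i"] by (simp add: abs_mult algebra_simps)
    with *[of 1] *[of "-1"] show ?thesis
      by (simp add: algebra_simps abs_le_iff)
  qed
  then show "s \<in> {s. \<forall>i. \<bar>s $ i\<bar> \<le> 1 \<and> s $ i * x $ i = \<bar>x $ i\<bar>}" by simp
next
  fix s assume "s \<in> {s. \<forall>i. \<bar>s $ i\<bar> \<le> 1 \<and> s $ i * x $ i = \<bar>x $ i\<bar>}"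
  then have s: "\<bar>s $ i\<bar> \<le> 1" "s $ i * x $ i = \<bar>x $ i\<bar>" for i by auto
  have "l1_norm x + s \<bullet> (y - x) \<le> l1_norm y" for y
  proof -
    have "s $ i * y $ i \<le> \<bar>y $ i\<bar>" for i
      using mult_right_mono[OF s(1)[of i], of "\<bar>y $ i\<bar>"] by (simp add: abs_mult[symmetric])
    then show ?thesis
      unfolding l1_norm_def inner_vec_def sum.distrib[symmetric]
      by (intro sum_mono) (simp add: algebra_simps s(2))
  qed
  then show "s \<in> subdifferential l1_norm x" by (simp add: subdifferential_def)
qed

text \<open>Serves to make the sum of a subdifferential and a closed cone closed, so that the
  distance in the acceptance criterion is attained.\<close>

lemma compact_subdifferential_l1_norm: "compact (subdifferential l1_norm (x :: real ^ 'n))"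
proof -
  have "closed {s :: real ^ 'n. \<forall>i. \<bar>s $ i\<bar> \<le> 1 \<and> s $ i * x $ i = \<bar>x $ i\<bar>}"
    by (intro closed_Collect_all closed_Collect_conj closed_Collect_le closed_Collect_eq
        continuous_intros)
  moreover have "bounded {s :: real ^ 'n. \<forall>i. \<bar>s $ i\<bar> \<le> 1 \<and> s $ i * x $ i = \<bar>x $ i\<bar>}"
  proof (rule boundedI)
    fix s :: "real ^ 'n" assume "s \<in> {s. \<forall>i. \<bar>s $ i\<bar> \<le> 1 \<and> s $ i * x $ i = \<bar>x $ i\<bar>}"
    then have "(\<Sum>i\<in>UNIV. \<bar>s $ i\<bar>) \<le> (\<Sum>i\<in>(UNIV :: 'n set). 1)" by (intro sum_mono) simp
    then show "norm s \<le> (\<Sum>i\<in>(UNIV :: 'n set). 1)"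
      using norm_le_l1_cart order_trans by blast
  qed
  ultimately show ?thesis by (simp add: subdifferential_l1_norm compact_eq_bounded_closed)
qed

lemma normal_cone_ball:
  fixes u :: "'a::real_inner"
  assumes "c > 0"
  shows "normal_cone {z. (norm z)\<^sup>2 \<le> c} u =
    (if (norm u)\<^sup>2 \<le> c then {l *\<^sub>R u | l. l \<ge> 0 \<and> l * ((norm u)\<^sup>2 - c) = 0} else {})"
proof (cases "(norm u)\<^sup>2 \<le> c")
  case True
  have "v \<in> normal_cone {z. (norm z)\<^sup>2 \<le> c} u \<longleftrightarrow>
    v \<in> {l *\<^sub>R u | l. l \<ge> 0 \<and> l * ((norm u)\<^sup>2 - c) = 0}" for v
  proof
    assume v: "v \<in> normal_cone {z. (norm z)\<^sup>2 \<le> c} u"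
    show "v \<in> {l *\<^sub>R u | l. l \<ge> 0 \<and> l * ((norm u)\<^sup>2 - c) = 0}"
    proof (cases "v = 0")
      case True then show ?thesis by (auto intro: exI[of _ 0])
    next
      case False
      \<comment> \<open>This \<open>z\<close> maximizes the inner product with \<open>v\<close> over
        the ball. Comparison with it puts \<open>u\<close> on the sphere and forces equality in
        Cauchy-Schwarz, so \<open>v\<close> is a nonnegative multiple of \<open>u\<close>.\<close>
      define z where "z = (sqrt c / norm v) *\<^sub>R v"
      have "(norm z)\<^sup>2 = c" using False assms by (simp add: z_def power_divide)
      with v True have "v \<bullet> (z - u) \<le> 0" by (simp add: normal_cone_def)
      moreover have "v \<bullet> z = sqrt c * norm v"
        using False by (simp add: z_def power2_norm_eq_inner[symmetric] power2_eq_square)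
      ultimately have le: "sqrt c * norm v \<le> v \<bullet> u" by (simp add: inner_diff_right)
      also have cs: "v \<bullet> u \<le> norm v * norm u" by (rule norm_cauchy_schwarz)
      finally have "sqrt c \<le> norm u" using False by (simp add: mult.commute)
      then have "c \<le> (norm u)\<^sup>2" using assms real_le_lsqrt real_sqrt_le_iff
        by (metis norm_ge_zero real_sqrt_unique)
      with True have eq: "(norm u)\<^sup>2 = c" by simp
      then have nu: "norm u = sqrt c" "norm u > 0"
        using assms by (auto simp: real_sqrt_unique[symmetric])
      with le cs have "v \<bullet> u = norm v * norm u" by (simp add: mult.commute)
      then have vu: "norm v *\<^sub>R u = norm u *\<^sub>R v" by (simp add: norm_cauchy_schwarz_eq)
      have "v = (1 / norm u) *\<^sub>R (norm u *\<^sub>R v)" using nu by simp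
      also have "\<dots> = (1 / norm u) *\<^sub>R (norm v *\<^sub>R u)"
        using vu by simp
      finally have "v = (norm v / norm u) *\<^sub>R u" by simp
      with eq show ?thesis by (auto intro!: exI[of _ "norm v / norm u"])
    qed
  next
    assume "v \<in> {l *\<^sub>R u | l. l \<ge> 0 \<and> l * ((norm u)\<^sup>2 - c) = 0}"
    then obtain l where l: "v = l *\<^sub>R u" "l \<ge> 0" "l = 0 \<or> (norm u)\<^sup>2 = c" by auto
    have "v \<bullet> (z - u) \<le> 0" if "(norm z)\<^sup>2 \<le> c" for z
    proof (cases "l = 0")
      case False
      then have u: "(norm u)\<^sup>2 = c" using l by simp
      then have "norm z \<le> norm u" using that by (simp add: power2_le_imp_le)
      then have "norm u * norm z \<le> norm u * norm u" by (intro mult_left_mono) auto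
      then have "u \<bullet> z \<le> u \<bullet> u"
        using norm_cauchy_schwarz[of u z]
        by (simp add: power2_norm_eq_inner[symmetric] power2_eq_square)
      with l show ?thesis by (simp add: inner_diff_right mult_left_mono)
    qed (use l in simp)
    with True show "v \<in> normal_cone {z. (norm z)\<^sup>2 \<le> c} u" by (simp add: normal_cone_def)
  qed
  with True show ?thesis by auto
qed (simp add: normal_cone_def)

lemma edist_set_attained:
  fixes p :: "'a::heine_borel"
  assumes "closed S" "edist_set p S \<le> ereal e"
  obtains q where "q \<in> S" "dist p q \<le> e"
proof -
  \<comment> \<open>The infimum over the empty set is \<open>\<infinity>\<close>, which no real
    \<open>e\<close> bounds.\<close>
  have "S \<noteq> {}" using assms(2) by (auto simp: edist_set_def top_ereal_def)
  then obtain q where q: "q \<in> S" "\<And>y. y \<in> S \<Longrightarrow> dist p q \<le> dist p y"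
    using distance_attains_inf[OF assms(1)] by blast
  have "ereal (dist p q) \<le> edist_set p S"
    unfolding edist_set_def by (intro INF_greatest) (simp add: q)
  with assms(2) have "dist p q \<le> e" by (metis ereal_less_eq(3) order_trans)
  with q that show ?thesis by blast
qed

section \<open>Instances for the two penalties and the signs of their slopes\<close>

lemma cond_A1_penalty:
  assumes "cond_A1 \<psi>"
  shows "concave_penalty \<psi> (right_deriv \<psi> 0)" and "t \<ge> 0 \<Longrightarrow> right_deriv \<psi> t > 0"
proof -
  obtain L where L: "L > 0" "(deriv \<psi> \<longlongrightarrow> L) (at_right 0)"
    using assms by (auto simp: cond_A1_def)
  interpret concave_penalty \<psi> L
    using assms L
    by unfold_locales (auto simp: cond_A1_def strictly_concave_on_imp_concave_on)
  show "concave_penalty \<psi> (right_deriv \<psi> 0)"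
    unfolding right_deriv_0 by (rule concave_penalty_axioms)
  show "right_deriv \<psi> t > 0" if "t \<ge> 0"
    using that assms L right_deriv_pos[of t] right_deriv_0
    by (cases "t = 0") (auto simp: cond_A1_def)
qed

lemma cond_A2_penalty:
  assumes "cond_A2 \<phi>"
  shows "concave_penalty \<phi> (right_deriv \<phi> 0)" and "right_deriv \<phi> 0 > 0"
    and "t \<ge> 0 \<Longrightarrow> right_deriv \<phi> t \<ge> 0"
proof -
  obtain L where L: "L > 0" "(deriv \<phi> \<longlongrightarrow> L) (at_right 0)"
    using assms by (auto simp: cond_A2_def)
  interpret concave_penalty \<phi> L
    using assms L by unfold_locales (auto simp: cond_A2_def)
  show "concave_penalty \<phi> (right_deriv \<phi> 0)"
    unfolding right_deriv_0 by (rule concave_penalty_axioms)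
  show "right_deriv \<phi> 0 > 0" using L by (simp add: right_deriv_0)
  show "right_deriv \<phi> t \<ge> 0" if "t \<ge> 0"
    using that assms L right_deriv_pos[of t] right_deriv_0
    by (cases "t = 0") (auto simp: cond_A2_def)
qed

section \<open>Sequences and entrywise products\<close>

lemma norm_vec_times_le: "norm (u * v :: real ^ 'i) \<le> norm u * norm v"
proof -
  have "norm (u * v) \<le> norm (norm u *\<^sub>R v)"
    by (rule norm_le_componentwise_cart)
      (auto simp: abs_mult intro: mult_right_mono component_le_norm_cart)
  then show ?thesis by simp
qed

lemma norm_vec_power2: "(norm (u :: real ^ 'i))\<^sup>2 = (\<Sum>i\<in>UNIV. (u $ i)\<^sup>2)"
  unfolding power2_norm_eq_inner inner_vec_def by (simp add: power2_eq_square)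

lemma inner_vec_times: "(u * v :: real ^ 'i) \<bullet> z = u \<bullet> (v * z)"
  by (simp add: inner_vec_def mult.assoc)

lemma tendsto_vec_times:
  fixes f g :: "'a \<Rightarrow> real ^ 'i"
  assumes "(f \<longlongrightarrow> a) F" "(g \<longlongrightarrow> b) F"
  shows "((\<lambda>k. f k * g k) \<longlongrightarrow> a * b) F"
  by (rule vec_tendstoI) (auto intro!: tendsto_mult tendsto_vec_nth assms)

lemma bounded_range_compose:
  fixes X :: "nat \<Rightarrow> 'a::heine_borel" and G :: "'a \<Rightarrow> 'b::metric_space"
  assumes "bounded (range X)" "continuous_on UNIV G"
  shows "bounded (range (\<lambda>k. G (X k)))"
proof -
  have "compact (closure (range X))" using assms(1) by (simp add: compact_closure)
  then have "bounded (G ` closure (range X))"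
    using assms(2) by (metis compact_continuous_image compact_imp_bounded continuous_on_subset subset_UNIV)
  then show ?thesis
    by (rule bounded_subset) (use closure_subset in blast)
qed

lemma bounded_range_Pair:
  assumes "bounded (range X)" "bounded (range Y)"
  shows "bounded (range (\<lambda>k. (X k, Y k)))"
  using bounded_Times[OF assms] by (rule bounded_subset) auto

lemma bounded_range_add:
  fixes X Y :: "nat \<Rightarrow> 'a::real_normed_vector"
  assumes "bounded (range X)" "bounded (range Y)"
  shows "bounded (range (\<lambda>k. X k + Y k))"
proof -
  obtain B C where "\<And>k. norm (X k) \<le> B" "\<And>k. norm (Y k) \<le> C"
    using assms by (auto simp: bounded_iff)
  then show ?thesis
    by (intro boundedI[of _ "B + C"]) (auto intro: order_trans[OF norm_triangle_ineq] add_mono)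
qed

lemma bounded_range_inner_null:
  fixes X Y :: "nat \<Rightarrow> 'a::real_inner"
  assumes "bounded (range X)" "Y \<longlonglongrightarrow> 0"
  shows "(\<lambda>k. X k \<bullet> Y k) \<longlonglongrightarrow> 0"
proof -
  obtain C where C: "\<And>k. norm (X k) \<le> C"
    using assms(1) by (auto simp: bounded_iff)
  have "norm (X k \<bullet> Y k) \<le> C * norm (Y k)" for k
    using Cauchy_Schwarz_ineq2[of "X k" "Y k"] mult_right_mono[OF C, of "norm (Y k)" k] by simp
  moreover have "(\<lambda>k. C * norm (Y k)) \<longlonglongrightarrow> 0"
    using tendsto_mult_right_zero[OF tendsto_norm_zero[OF assms(2)], of C] by simp
  ultimately show ?thesis
    by (rule Lim_null_comparison[OF always_eventually, OF allI])
qed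

lemma bounded_range_mult_null:
  fixes X Y :: "nat \<Rightarrow> real"
  assumes "bounded (range X)" "Y \<longlonglongrightarrow> 0"
  shows "(\<lambda>k. X k * Y k) \<longlonglongrightarrow> 0"
  using bounded_range_inner_null[OF assms] by simp

lemma tendsto_0_if_square:
  fixes X :: "nat \<Rightarrow> 'a::real_normed_vector"
  assumes "(\<lambda>k. (norm (X k))\<^sup>2) \<longlonglongrightarrow> 0"
  shows "X \<longlonglongrightarrow> 0"
  using tendsto_real_sqrt[OF assms] by (simp add: tendsto_norm_zero_iff)

lemma eventually_bounded_imp_bounded_range:
  fixes X :: "nat \<Rightarrow> 'a::real_normed_vector"
  assumes "\<forall>\<^sub>F k in sequentially. norm (X k) \<le> C"
  shows "bounded (range X)"
proof -
  obtain K where "\<And>k. norm (X k) \<le> K"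
    using BfunI[OF assms] by (meson BseqE)
  then show ?thesis by (auto intro: boundedI)
qed

text \<open>Subtracting the partial sums of \<open>\<mu>\<close> leaves a decreasing sequence that
  is bounded below by \<open>- suminf \<mu>\<close>; hence \<open>a\<close> itself
  converges.\<close>

lemma almost_decreasing_difference_null:
  fixes a \<mu> :: "nat \<Rightarrow> real"
  assumes dec: "\<And>k. a (Suc k) \<le> a k + \<mu> k" and pos: "\<And>k. 0 \<le> a k"
    and \<mu>: "\<And>k. 0 \<le> \<mu> k" "summable \<mu>"
  shows "(\<lambda>k. a k - a (Suc k)) \<longlonglongrightarrow> 0" and "a k \<le> a 0 + suminf \<mu>"
proof -
  define d where "d k = a k - sum \<mu> {..<k}" for k
  have le: "sum \<mu> {..<k} \<le> suminf \<mu>" for k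
    using \<mu> by (intro sum_le_suminf) auto
  have decd: "decseq d"
    by (rule decseq_SucI) (use dec in \<open>simp add: d_def algebra_simps\<close>)
  have "- suminf \<mu> \<le> d k" for k
    using le[of k] pos[of k] by (simp add: d_def)
  then obtain l where "d \<longlonglongrightarrow> l"
    using decseq_convergent[OF decd] by blast
  moreover have "(\<lambda>k. sum \<mu> {..<k}) \<longlonglongrightarrow> suminf \<mu>"
    using \<mu> by (simp add: summable_LIMSEQ)
  ultimately have "(\<lambda>k. d k + sum \<mu> {..<k}) \<longlonglongrightarrow> l + suminf \<mu>"
    by (rule tendsto_add)
  then have a: "a \<longlonglongrightarrow> l + suminf \<mu>" by (simp add: d_def)
  show "(\<lambda>k. a k - a (Suc k)) \<longlonglongrightarrow> 0"
    using tendsto_diff[OF a LIMSEQ_Suc[OF a]] by simp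
  have "d k \<le> d 0" using decd by (simp add: decseq_def)
  then show "a k \<le> a 0 + suminf \<mu>" using le[of k] by (simp add: d_def)
qed

section \<open>The majorized subproblem\<close>

locale ir_problem =
  fixes \<psi> \<phi> :: "real \<Rightarrow> real" and A :: "real ^ 'n ^ 'm" and b :: "real ^ 'm" and \<sigma> :: real
  assumes A1: "cond_A1 \<psi>" and A2: "cond_A2 \<phi>" and A3: "cond_A3 \<phi> A b \<sigma>"
    and A4: "cond_A4 \<phi> \<sigma> CARD('m)"
begin

abbreviation res :: "real ^ 'n \<Rightarrow> real ^ 'm" where "res z \<equiv> A *v z - b"
abbreviation F :: "real ^ 'n \<Rightarrow> real" where "F \<equiv> constraint_fun \<phi> A b"
abbreviation w :: "real ^ 'n \<Rightarrow> real ^ 'n" where "w \<equiv> IR_w \<psi>"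
abbreviation v :: "real ^ 'n \<Rightarrow> real ^ 'm" where "v \<equiv> IR_v \<phi> A b"
abbreviation S :: "real ^ 'n \<Rightarrow> real" where "S \<equiv> IR_sigma \<phi> A b \<sigma>"
text \<open>A point of zero residual. The map \<open>IR_P\<close> pulls towards it, and it is the
  test point that bounds the multipliers.\<close>

abbreviation d :: "real ^ 'n" where "d \<equiv> pseudoinverse A *v b"

sublocale psi: concave_penalty \<psi> "right_deriv \<psi> 0"
  by (rule cond_A1_penalty[OF A1])

sublocale phi: concave_penalty \<phi> "right_deriv \<phi> 0"
  by (rule cond_A2_penalty[OF A2])

lemma A_d: "A *v d = b"
  using A3 by (simp add: cond_A3_def full_row_rank_pseudoinverse)

lemma w_nth: "w x $ i = right_deriv \<psi> \<bar>x $ i\<bar>"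
  by (simp add: IR_w_def sep_right_deriv_def abs_vec_def)

lemma w_pos: "w x $ i > 0"
  by (simp add: w_nth cond_A1_penalty[OF A1])

lemma v_nth: "v x $ i = sqrt (right_deriv \<phi> ((res x $ i)\<^sup>2))"
  by (simp add: IR_v_def IR_y_def sep_right_deriv_def power2_eq_square algebra_simps)

lemma v_sq: "(v x $ i)\<^sup>2 = right_deriv \<phi> ((res x $ i)\<^sup>2)"
  by (simp add: v_nth cond_A2_penalty[OF A2])

lemma IR_A_mult: "IR_A \<phi> A b x *v z = v x * (A *v z)"
proof -
  have "diag u *v z = u * z" for u z :: "real ^ 'm"
    by (vector diag_def matrix_vector_mult_def) (simp add: if_distrib if_distribR cong: if_cong)
  then show ?thesis by (simp add: IR_A_def matrix_vector_mul_assoc[symmetric])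
qed

lemma IR_residual: "IR_A \<phi> A b x *v z - IR_b \<phi> A b x = v x * res z"
  by (simp add: IR_A_mult IR_b_def right_diff_distrib)

lemma transpose_IR_A_inner: "(transpose (IR_A \<phi> A b x) *v u) \<bullet> z = u \<bullet> (v x * (A *v z))"
  by (simp add: dot_lmul_matrix IR_A_mult)

lemma transpose_IR_A: "transpose (IR_A \<phi> A b x) *v u = transpose A *v (v x * u)"
proof -
  have "(transpose (IR_A \<phi> A b x) *v u) \<bullet> z = (transpose A *v (v x * u)) \<bullet> z" for z
    unfolding transpose_IR_A_inner
    by (simp add: dot_lmul_matrix mult.commute[of "v x"] inner_vec_times)
  then show ?thesis by (metis vector_eq_rdot)
qed

lemma F_eq: "F x = (\<Sum>i\<in>UNIV. \<phi> ((res x $ i)\<^sup>2))"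
  by (simp add: constraint_fun_def sep_sum_def power2_eq_square algebra_simps)

lemma S_eq: "S x = \<sigma> + (norm (v x * res x))\<^sup>2 - F x"
proof -
  have "IR_b \<phi> A b x - IR_A \<phi> A b x *v x = - (v x * res x)"
    by (metis IR_residual minus_diff_eq)
  then show ?thesis
    by (simp add: IR_sigma_def IR_y_def constraint_fun_def)
qed

text \<open>The tangent inequality of \<open>\<phi>\<close> at the squared residuals of
  \<open>x\<close>, summed over the entries; the squares of \<open>v x\<close> are the
  slopes.\<close>

lemma F_majorant: "F z \<le> F x + (norm (v x * res z))\<^sup>2 - (norm (v x * res x))\<^sup>2"
proof -
  have "F z \<le> (\<Sum>i\<in>UNIV. \<phi> ((res x $ i)\<^sup>2)
    + right_deriv \<phi> ((res x $ i)\<^sup>2) * ((res z $ i)\<^sup>2 - (res x $ i)\<^sup>2))"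
    unfolding F_eq by (intro sum_mono phi.tangent) auto
  also have "\<dots> = F x + (norm (v x * res z))\<^sup>2 - (norm (v x * res x))\<^sup>2"
    unfolding F_eq norm_vec_power2 sum_subtractf[symmetric] sum.distrib[symmetric]
    by (intro sum.cong refl) (simp add: v_sq power_mult_distrib right_diff_distrib[where a = "right_deriv \<phi> t" for t]
        del: vector_minus_component)
  finally show ?thesis .
qed

text \<open>The value \<open>S x\<close> is exactly the squared radius at which the majorant around
  \<open>x\<close> reaches \<open>\<sigma>\<close>.\<close>

lemma F_le_if_subproblem_feasible:
  assumes "(norm (v x * res z))\<^sup>2 \<le> S x"
  shows "F z \<le> \<sigma>"
  using F_majorant[of z x] assms by (simp add: S_eq)

text \<open>If \<open>S x = 0\<close>, every nonzero residual sits where \<open>\<phi>\<close> is already maximal, so that \<open>\<sigma>\<close> is a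
  multiple of \<open>sup \<phi>\<close>; this is what (A4) excludes.\<close>

lemma S_pos:
  assumes "F x \<le> \<sigma>"
  shows "S x > 0"
proof (rule ccontr)
  assume "\<not> S x > 0"
  \<comment> \<open>By \<open>S_eq\<close>, \<open>S x\<close> is the sum of the nonnegative terms
    \<open>\<sigma> - F x\<close> and \<open>(norm (v x * res x))^2\<close>, so both vanish.\<close>
  then have "F x = \<sigma>" and "(norm (v x * res x))\<^sup>2 = 0"
    using assms zero_le_power2[of "norm (v x * res x)"] S_eq[of x] by linarith+
  then have vr: "v x $ i = 0 \<or> res x $ i = 0" for i
    by (simp add: vec_eq_iff)
  define K where "K = {i. v x $ i = 0}"
  have max: "ereal (\<phi> ((res x $ i)\<^sup>2)) = phi_sup \<phi>" if "i \<in> K" for i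
  proof -
    have "right_deriv \<phi> ((res x $ i)\<^sup>2) = 0"
      using that v_sq[of x i] by (simp add: K_def)
    then have "\<phi> s \<le> \<phi> ((res x $ i)\<^sup>2)" if "s \<ge> 0" for s
      using phi.tangent[of "(res x $ i)\<^sup>2" s] that by simp
    then show ?thesis
      unfolding phi_sup_def by (intro antisym SUP_upper SUP_least) auto
  qed
  have "\<sigma> = (\<Sum>i\<in>UNIV. \<phi> ((res x $ i)\<^sup>2))"
    using \<open>F x = \<sigma>\<close> by (simp add: F_eq)
  also have "\<dots> = (\<Sum>i\<in>K. \<phi> ((res x $ i)\<^sup>2))"
  proof (rule sum.mono_neutral_right)
    show "\<forall>i\<in>UNIV - K. \<phi> ((res x $ i)\<^sup>2) = 0"
    proof
      fix i assume "i \<in> UNIV - K"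
      then have "res x $ i = 0" using vr[of i] unfolding K_def by blast
      then show "\<phi> ((res x $ i)\<^sup>2) = 0" by (simp only: phi.zero zero_power2)
    qed
  qed auto
  finally have \<sigma>: "\<sigma> = (\<Sum>i\<in>K. \<phi> ((res x $ i)\<^sup>2))" .
  \<comment> \<open>Positivity of \<open>\<sigma>\<close> makes \<open>K\<close> nonempty, which
    puts the factor \<open>card K\<close> into the range \<open>{1..CARD('m)}\<close>.\<close>
  have "\<sigma> > 0" using A3 by (simp add: cond_A3_def)
  then have "K \<noteq> {}" using \<sigma> by auto
  then obtain j where j: "j \<in> K" by auto
  have "\<phi> ((res x $ i)\<^sup>2) = \<phi> ((res x $ j)\<^sup>2)" if "i \<in> K" for i
    using max[OF that] max[OF j] by (metis ereal.inject)
  with \<sigma> have "\<sigma> = real (card K) * \<phi> ((res x $ j)\<^sup>2)" by simp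
  then have "ereal \<sigma> = ereal (real (card K)) * phi_sup \<phi>"
    by (simp flip: max[OF j])
  moreover have "card K \<in> {1..CARD('m)}"
    using \<open>K \<noteq> {}\<close> by (auto simp: card_gt_0_iff Suc_le_eq intro: card_mono)
  ultimately show False using A4 unfolding cond_A4_def by blast
qed

section \<open>Continuity of the weights, the constraint function and the squared radius\<close>

lemma continuous_on_right_deriv_compose:
  assumes "continuous_on {0..} h" "continuous_on U g" "\<And>x. x \<in> U \<Longrightarrow> g x \<ge> 0"
  shows "continuous_on U (\<lambda>x. h (g x :: real) :: real)"
  by (rule continuous_on_compose2[OF assms(1,2)]) (use assms(3) in auto)

lemma continuous_on_w: "continuous_on UNIV w"
proof -
  have "w = (\<lambda>x. \<chi> i. right_deriv \<psi> \<bar>x $ i\<bar>)" by (simp add: fun_eq_iff vec_eq_iff w_nth)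
  moreover have "continuous_on UNIV (\<lambda>x :: real ^ 'n. right_deriv \<psi> \<bar>x $ i\<bar>)" for i
    by (rule continuous_on_right_deriv_compose[OF psi.continuous_on_right_deriv])
      (auto intro!: continuous_intros)
  ultimately show ?thesis by (simp add: continuous_on_vec_lambda)
qed

lemma continuous_on_res_nth: "continuous_on UNIV (\<lambda>x. res x $ i)"
  by (intro continuous_intros)

lemma continuous_on_v: "continuous_on UNIV v"
proof -
  have "v = (\<lambda>x. \<chi> i. sqrt (right_deriv \<phi> ((res x $ i)\<^sup>2)))"
    unfolding fun_eq_iff vec_eq_iff vec_lambda_beta v_nth by blast
  moreover have "continuous_on UNIV (\<lambda>x :: real ^ 'n. right_deriv \<phi> ((res x $ i)\<^sup>2))" for i
    by (rule continuous_on_right_deriv_compose[OF phi.continuous_on_right_deriv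
          continuous_on_power[OF continuous_on_res_nth]]) simp
  ultimately show ?thesis
    by (simp only: continuous_on_vec_lambda continuous_on_real_sqrt)
qed

lemma continuous_on_F: "continuous_on UNIV F"
proof -
  have "continuous_on UNIV (\<lambda>x :: real ^ 'n. \<phi> ((res x $ i)\<^sup>2))" for i
    by (rule continuous_on_right_deriv_compose[OF phi.cont
          continuous_on_power[OF continuous_on_res_nth]]) simp
  moreover have "F = (\<lambda>x. \<Sum>i\<in>UNIV. \<phi> ((res x $ i)\<^sup>2))" by (simp only: fun_eq_iff F_eq simp_thms)
  ultimately show ?thesis by (simp only: continuous_on_sum)
qed

lemma continuous_on_scaled_res: "continuous_on UNIV (\<lambda>x. v x * res x)"
proof -
  have "continuous_on UNIV res" by (intro continuous_intros)
  with continuous_on_v show ?thesis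
    unfolding continuous_on_def by (intro ballI tendsto_vec_times) auto
qed

lemma continuous_on_S: "continuous_on UNIV S"
proof -
  have "S = (\<lambda>x. \<sigma> + (norm (v x * res x))\<^sup>2 - F x)" by (simp add: fun_eq_iff S_eq)
  then show ?thesis
    by (simp only:) (intro continuous_intros continuous_on_F continuous_on_scaled_res)
qed

section \<open>The pull-back map and the acceptance criterion\<close>

lemma IR_P_feasible_and_close:
  fixes x z :: "real ^ 'n"
  defines "P \<equiv> IR_P \<phi> A b \<sigma> x z"
  assumes S: "S x > 0" and near: "norm (v x * res z) \<le> sqrt (S x) + e" and e: "e > 0"
  shows "(norm (v x * res P))\<^sup>2 \<le> S x"
    and "norm (z - P) \<le> e / sqrt (S x) * norm (P - d)"
proof -
  let ?r = "norm (v x * res z)"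
  have "(norm (v x * res P))\<^sup>2 \<le> S x \<and> norm (z - P) \<le> e / sqrt (S x) * norm (P - d)"
  proof (cases "?r\<^sup>2 \<le> S x")
    case True
    then have "P = z" by (simp add: P_def IR_P_def Let_def IR_residual)
    with True S e show ?thesis by simp
  next
    case False
    \<comment> \<open>As the residual of \<open>d\<close> is zero, moving from \<open>z\<close> to
      the convex combination with \<open>d\<close> multiplies the residual by \<open>t\<close>. This
      value of \<open>t\<close> brings it to the boundary of the ball.\<close>
    define t where "t = sqrt (S x) / ?r"
    have P: "P = (1 - t) *\<^sub>R d + t *\<^sub>R z"
      using False by (simp add: P_def IR_P_def Let_def IR_residual t_def)
    have r: "?r > sqrt (S x)"
      using False by (metis not_le norm_ge_zero real_sqrt_le_iff real_sqrt_abs abs_of_nonneg)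
    have s0: "sqrt (S x) > 0" using S by simp
    with r have r0: "?r > 0" by linarith
    with r s0 have t: "0 < t" "t < 1"
      unfolding t_def by (auto simp only: divide_pos_pos divide_less_eq_1_pos)
    have "A *v P = (1 - t) *\<^sub>R b + t *\<^sub>R (A *v z)"
      by (simp add: P matrix_vector_right_distrib matrix_vector_mult_scaleR A_d)
    then have "res P = t *\<^sub>R res z" by (simp add: algebra_simps)
    then have "v x * res P = t *\<^sub>R (v x * res z)" by (simp add: vec_eq_iff)
    then have "norm (v x * res P) = t * ?r" using t by simp
    then have 1: "(norm (v x * res P))\<^sup>2 = S x" using r0 S by (simp add: t_def)
    \<comment> \<open>The distance is expressed through \<open>P - d\<close> instead of
      \<open>z - d\<close>: \<open>P\<close> becomes the next iterate, and the iterates are bounded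
      before anything is known about \<open>z\<close>.\<close>
    have Pd: "P - d = t *\<^sub>R (z - d)" by (simp add: P algebra_simps)
    have "z - P = (1 - t) *\<^sub>R (z - d)" by (simp add: P algebra_simps)
    also have "\<dots> = ((1 - t) / t) *\<^sub>R (P - d)" using t by (simp add: Pd)
    finally have "norm (z - P) = (1 - t) / t * norm (P - d)" using t by simp
    also have "(1 - t) / t = (?r - sqrt (S x)) / sqrt (S x)"
      using r0 S by (simp add: t_def field_simps)
    also have "\<dots> * norm (P - d) \<le> e / sqrt (S x) * norm (P - d)"
      using near S by (intro mult_right_mono divide_right_mono) auto
    finally show ?thesis using 1 by simp
  qed
  then show "(norm (v x * res P))\<^sup>2 \<le> S x" "norm (z - P) \<le> e / sqrt (S x) * norm (P - d)" by auto
qed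

lemma IR_stepD:
  assumes "IR_step \<psi> \<phi> A b \<sigma> m e x z u" "S x > 0"
  shows "(norm u)\<^sup>2 \<le> S x" and "norm (v x * res z - u) \<le> e"
    and "l1_norm (w x * IR_P \<phi> A b \<sigma> x z) \<le> l1_norm (w x * x) + m"
proof -
  show "norm (v x * res z - u) \<le> e"
    and "l1_norm (w x * IR_P \<phi> A b \<sigma> x z) \<le> l1_norm (w x * x) + m"
    using assms by (auto simp: IR_step_def IR_residual)
  show "(norm u)\<^sup>2 \<le> S x"
  proof (rule ccontr)
    assume "\<not> (norm u)\<^sup>2 \<le> S x"
    \<comment> \<open>Outside the ball the normal cone is empty and the distance in the criterion is
      infinite.\<close>
    with assms(1) show False
      by (simp add: IR_step_def normal_cone_def edist_set_def set_plus_def top_ereal_def)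
  qed
qed

text \<open>The criterion only bounds an infimum. It is attained because the set is the sum of a
  compact set and a closed one, the linear image of the normal cone.\<close>

lemma IR_multiplier_exists:
  assumes step: "IR_step \<psi> \<phi> A b \<sigma> m e x z u" and S: "S x > 0"
  shows "\<exists>\<xi> l. IR_multiplier \<psi> \<phi> A b \<sigma> e x z u \<xi> l"
proof -
  let ?W = "(\<lambda>s. w x * s) ` subdifferential l1_norm z"
  let ?p = "transpose (IR_A \<phi> A b x) *v u"
  let ?R = "(\<lambda>q. transpose (IR_A \<phi> A b x) *v q) ` normal_cone {z. (norm z)\<^sup>2 \<le> S x} u"
  have R: "?R = {l *\<^sub>R ?p | l. l \<ge> 0 \<and> l * ((norm u)\<^sup>2 - S x) = 0}"
  proof -
    have "normal_cone {z. (norm z)\<^sup>2 \<le> S x} u = (\<lambda>l. l *\<^sub>R u) ` {l. l \<ge> 0 \<and> l * ((norm u)\<^sup>2 - S x) = 0}"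
      using IR_stepD(1)[OF step S] by (auto simp: normal_cone_ball[OF S])
    then show ?thesis
      by (auto simp only: image_image matrix_vector_mult_scaleR)
  qed
  have "closed ?R"
  \<comment> \<open>The image of the cone is \<open>{0}\<close> in the first case and the full ray
    spanned by \<open>?p\<close> in the second; both are closed.\<close>
  proof (cases "?p = 0 \<or> (norm u)\<^sup>2 \<noteq> S x")
    case True
    then have "?R = {0}" unfolding R by (auto intro: exI[of _ 0])
    then show ?thesis by simp
  next
    case False
    then have "?R = (\<lambda>l. l *\<^sub>R ?p) ` {0..}" unfolding R by auto
    moreover have "closed ((\<lambda>l. l *\<^sub>R ?p) ` {0..})"
      using False by (intro closed_injective_linear_image) (auto intro!: linearI injI simp: algebra_simps)
    ultimately show ?thesis by simp
  qed
  moreover have "compact ?W"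
    by (intro compact_continuous_image compact_subdifferential_l1_norm)
      (auto simp: continuous_on_def intro!: tendsto_vec_times tendsto_intros)
  ultimately have "closed (\<Union>p\<in>?W. \<Union>q\<in>?R. {p + q})"
    by (intro compact_closed_sums)
  moreover have "(\<Union>p\<in>?W. \<Union>q\<in>?R. {p + q}) = ?W + ?R"
    by (auto simp: set_plus_def)
  ultimately have "closed (?W + ?R)" by simp
  moreover have "edist_set 0 (?W + ?R) \<le> ereal e" using step by (simp add: IR_step_def)
  ultimately obtain \<xi> where \<xi>: "\<xi> \<in> ?W + ?R" "norm \<xi> \<le> e"
    by (rule edist_set_attained) auto
  then obtain l where "\<xi> \<in> ?W + {l *\<^sub>R ?p}" "l \<ge> 0" "l * ((norm u)\<^sup>2 - S x) = 0"
    unfolding R set_plus_def by blast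
  with \<xi> show ?thesis unfolding IR_multiplier_def by blast
qed

end

lemma l1_norm_times:
  assumes "\<And>i. w $ i > 0"
  shows "l1_norm (w * z :: real ^ 'i) = (\<Sum>i\<in>UNIV. w $ i * \<bar>z $ i\<bar>)"
  unfolding l1_norm_def using assms by (intro sum.cong) (auto simp: abs_mult less_imp_le)

section \<open>The iterates\<close>

text \<open>Here \<open>y k\<close> and \<open>u k\<close> are computed from \<open>x k\<close>;
  they are the \<open>xt (Suc k)\<close> and \<open>ut (Suc k)\<close> of
  \<open>IR_sequence\<close>. The sequence \<open>\<tau>\<close> is represented by its consequence
  \<open>eps_lim\<close>.\<close>

locale ir_run = ir_problem \<psi> \<phi> A b \<sigma>
  for \<psi> \<phi> :: "real \<Rightarrow> real" and A :: "real ^ 'n ^ 'm" and b :: "real ^ 'm" and \<sigma> :: real +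
  fixes \<mu> \<epsilon> :: "nat \<Rightarrow> real" and x y :: "nat \<Rightarrow> real ^ 'n" and u :: "nat \<Rightarrow> real ^ 'm"
  assumes mu_pos: "\<And>k. \<mu> k > 0" and mu_summable: "summable \<mu>"
    and eps_pos: "\<And>k. \<epsilon> k > 0" and eps_lim: "\<epsilon> \<longlonglongrightarrow> 0"
    and init: "F (x 0) \<le> \<sigma>"
    and step: "\<And>k. IR_step \<psi> \<phi> A b \<sigma> (\<mu> k) (\<epsilon> k) (x k) (y k) (u k)"
    and next_iterate: "\<And>k. x (Suc k) = IR_P \<phi> A b \<sigma> (x k) (y k)"
begin

abbreviation wnorm :: "nat \<Rightarrow> real ^ 'n \<Rightarrow> real" where
  "wnorm k z \<equiv> \<Sum>i\<in>UNIV. w (x k) $ i * \<bar>z $ i\<bar>"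

section \<open>Feasibility of the iterates and almost monotone objective\<close>

lemma near_ball:
  assumes "S (x k) > 0"
  shows "norm (v (x k) * res (y k)) \<le> sqrt (S (x k)) + \<epsilon> k"
proof -
  have "norm (u k) \<le> sqrt (S (x k))"
    using IR_stepD(1)[OF step assms] by (simp add: real_le_rsqrt)
  moreover have "norm (v (x k) * res (y k) - u k) \<le> \<epsilon> k"
    by (rule IR_stepD(2)[OF step assms])
  ultimately show ?thesis
    using norm_triangle_sub[of "v (x k) * res (y k)" "u k"] by linarith
qed

text \<open>Feasibility of \<open>x k\<close> gives \<open>S (x k) > 0\<close>; this is what
  \<open>IR_P\<close> needs to land in the ball, on which \<open>F\<close> is at most
  \<open>\<sigma>\<close>.\<close>

lemma feasible: "F (x k) \<le> \<sigma>"
proof (induction k)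
  case (Suc k)
  then have S: "S (x k) > 0" by (rule S_pos)
  show ?case
    unfolding next_iterate
    by (rule F_le_if_subproblem_feasible, rule IR_P_feasible_and_close(1)[OF S near_ball[OF S] eps_pos])
qed (rule init)

lemma S_x_pos: "S (x k) > 0"
  by (intro S_pos feasible)

lemmas u_ball = IR_stepD(1)[OF step S_x_pos]
lemmas u_near = IR_stepD(2)[OF step S_x_pos]

lemma wnorm_step: "wnorm k (x (Suc k)) \<le> wnorm k (x k) + \<mu> k"
  using IR_stepD(3)[OF step S_x_pos, of k] by (simp add: next_iterate l1_norm_times w_pos)

text \<open>The tangent inequality of \<open>\<psi>\<close> in each entry: \<open>w (x k)\<close>
  holds the slopes at the absolute values of \<open>x k\<close>.\<close>

lemma objective_step:
  "sep_sum \<psi> \<bar>x (Suc k)\<bar> \<le> sep_sum \<psi> \<bar>x k\<bar> + (wnorm k (x (Suc k)) - wnorm k (x k))"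
  unfolding sep_sum_def sum_subtractf[symmetric] sum.distrib[symmetric]
proof (rule sum_mono)
  fix i
  show "\<psi> (\<bar>x (Suc k)\<bar> $ i) \<le> \<psi> (\<bar>x k\<bar> $ i)
      + (w (x k) $ i * \<bar>x (Suc k) $ i\<bar> - w (x k) $ i * \<bar>x k $ i\<bar>)"
    using psi.tangent[of "\<bar>x k $ i\<bar>" "\<bar>x (Suc k) $ i\<bar>"]
    by (simp add: abs_vec_def w_nth right_diff_distrib)
qed

lemma psi_nonneg: "t \<ge> 0 \<Longrightarrow> \<psi> t \<ge> 0"
  using A1 by (simp add: cond_A1_def)

lemma objective_nonneg: "sep_sum \<psi> \<bar>z\<bar> \<ge> 0"
  unfolding sep_sum_def by (intro sum_nonneg psi_nonneg) (simp add: abs_vec_def)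

lemma objective_almost_decreasing: "sep_sum \<psi> \<bar>x (Suc k)\<bar> \<le> sep_sum \<psi> \<bar>x k\<bar> + \<mu> k"
  using objective_step[of k] wnorm_step[of k] by linarith

text \<open>The gap lies between \<open>- \<mu> k\<close> and the decrease of the objective, and
  both tend to \<open>0\<close>.\<close>

lemma wnorm_gap_null: "(\<lambda>k. wnorm k (x k) - wnorm k (x (Suc k))) \<longlonglongrightarrow> 0"
proof (rule tendsto_sandwich[OF always_eventually always_eventually])
  show "(\<lambda>k. - \<mu> k) \<longlonglongrightarrow> 0"
    using tendsto_minus[OF summable_LIMSEQ_zero[OF mu_summable]] by simp
  show "(\<lambda>k. sep_sum \<psi> \<bar>x k\<bar> - sep_sum \<psi> \<bar>x (Suc k)\<bar>) \<longlonglongrightarrow> 0"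
    by (rule almost_decreasing_difference_null(1)[OF objective_almost_decreasing objective_nonneg
          less_imp_le[OF mu_pos] mu_summable])
  show "\<forall>k. - \<mu> k \<le> wnorm k (x k) - wnorm k (x (Suc k))"
  proof
    fix k show "- \<mu> k \<le> wnorm k (x k) - wnorm k (x (Suc k))" using wnorm_step[of k] by linarith
  qed
  show "\<forall>k. wnorm k (x k) - wnorm k (x (Suc k)) \<le> sep_sum \<psi> \<bar>x k\<bar> - sep_sum \<psi> \<bar>x (Suc k)\<bar>"
  proof
    fix k show "wnorm k (x k) - wnorm k (x (Suc k)) \<le> sep_sum \<psi> \<bar>x k\<bar> - sep_sum \<psi> \<bar>x (Suc k)\<bar>"
      using objective_step[of k] by linarith
  qed
qed

section \<open>Boundedness and uniform positive lower bounds along the run\<close>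

lemma bounded_x: "bounded (range x)"
proof -
  define B where "B = sep_sum \<psi> \<bar>x 0\<bar> + suminf \<mu>"
  have B: "sep_sum \<psi> \<bar>x k\<bar> \<le> B" for k
    unfolding B_def
    by (rule almost_decreasing_difference_null(2)[OF objective_almost_decreasing objective_nonneg
          less_imp_le[OF mu_pos] mu_summable])
  \<comment> \<open>Coercivity of \<open>\<psi>\<close>: as all terms of the objective are
    nonnegative, a single entry beyond \<open>R\<close> would push it above its bound
    \<open>B\<close>.\<close>
  have "\<forall>\<^sub>F t in at_top. \<psi> t > B"
    using A1 by (auto simp: cond_A1_def filterlim_at_top_dense)
  then obtain R where R: "\<And>t. t \<ge> R \<Longrightarrow> \<psi> t > B"
    by (auto simp: eventually_at_top_linorder)
  have "\<bar>x k $ i\<bar> \<le> R" for k i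
  proof (rule ccontr)
    assume "\<not> \<bar>x k $ i\<bar> \<le> R"
    then have "B < \<psi> (\<bar>x k\<bar> $ i)" by (intro R) (simp add: abs_vec_def)
    also have "\<dots> \<le> sep_sum \<psi> \<bar>x k\<bar>"
      unfolding sep_sum_def by (intro member_le_sum psi_nonneg) (auto simp: abs_vec_def)
    also have "\<dots> \<le> B" by (rule B)
    finally show False by simp
  qed
  then have "norm (x k) \<le> (\<Sum>i\<in>(UNIV :: 'n set). R)" for k
    using norm_le_l1_cart[of "x k"] by (meson order_trans sum_mono)
  then show ?thesis by (auto intro!: boundedI)
qed

lemma compact_closure_x: "compact (closure (range x))"
  using bounded_x by (simp add: compact_closure)

lemma closure_x_feasible:
  assumes "z \<in> closure (range x)"
  shows "F z \<le> \<sigma>"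
proof -
  have "closed {z. F z \<le> \<sigma>}"
    by (intro closed_Collect_le continuous_on_F continuous_on_const)
  then have "closure (range x) \<subseteq> {z. F z \<le> \<sigma>}"
    using feasible by (intro closure_minimal) auto
  with assms show ?thesis by auto
qed

text \<open>The minimum is taken over the compact closure of the iterates. It may be attained at a
  limit point, so positivity is asked for there as well.\<close>

lemma positive_lower_bound:
  assumes "continuous_on UNIV G" "\<And>z. z \<in> closure (range x) \<Longrightarrow> (G z :: real) > 0"
  obtains c where "c > 0" "\<And>k. c \<le> G (x k)"
proof -
  have "closure (range x) \<noteq> {}" by simp
  then obtain z where z: "z \<in> closure (range x)" "\<And>z'. z' \<in> closure (range x) \<Longrightarrow> G z \<le> G z'"
    using continuous_attains_inf[OF compact_closure_x] assms(1) continuous_on_subset by blast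
  show ?thesis
  proof (rule that)
    show "G z > 0" by (intro assms z)
    show "G z \<le> G (x k)" for k using closure_subset[of "range x"] by (intro z) blast
  qed
qed

lemma S_lower_bound: obtains c where "c > 0" "\<And>k. c \<le> S (x k)"
  by (rule positive_lower_bound[OF continuous_on_S S_pos[OF closure_x_feasible]]) auto

lemma w_lower_bound: obtains c where "c > 0" "\<And>k i. c \<le> w (x k) $ i"
proof -
  have "\<exists>c>0. \<forall>k. c \<le> w (x k) $ i" for i
    by (rule positive_lower_bound[OF continuous_on_component[OF continuous_on_w, of i] w_pos]) auto
  then obtain c where c: "\<And>i. c i > 0" "\<And>i k. c i \<le> w (x k) $ i" by metis
  show ?thesis
  proof (rule that)
    show "Min (range c) > 0" using c by (subst Min_gr_iff) auto
    show "Min (range c) \<le> w (x k) $ i" for k i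
      using c(2) by (rule order_trans[rotated]) auto
  qed
qed

lemma bounded_w: "bounded (range (\<lambda>k. w (x k)))"
  by (rule bounded_range_compose[OF bounded_x continuous_on_w])

lemma bounded_v: "bounded (range (\<lambda>k. v (x k)))"
  by (rule bounded_range_compose[OF bounded_x continuous_on_v])

lemma bounded_u: "bounded (range u)"
proof -
  obtain C where C: "\<And>k. norm (S (x k)) \<le> C"
    using bounded_range_compose[OF bounded_x continuous_on_S] by (auto simp: bounded_iff)
  have "norm (u k) \<le> sqrt C" for k
    using u_ball[of k] C[of k] by (intro real_le_rsqrt) auto
  then show ?thesis by (auto intro!: boundedI)
qed

lemma bounded_IR_A_u: "bounded (range (\<lambda>k. transpose (IR_A \<phi> A b (x k)) *v u k))"
proof -
  have "continuous_on UNIV (\<lambda>p :: (real ^ 'm) \<times> (real ^ 'm). transpose A *v (fst p * snd p))"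
  proof -
    have "continuous_on UNIV (\<lambda>p :: (real ^ 'm) \<times> (real ^ 'm). fst p * snd p)"
      unfolding continuous_on_def by (intro ballI tendsto_vec_times tendsto_intros)
    then show ?thesis
      by (rule continuous_on_compose2[OF matrix_vector_mult_linear_continuous_on]) auto
  qed
  from bounded_range_compose[OF bounded_range_Pair[OF bounded_v bounded_u] this]
  show ?thesis by (simp only: transpose_IR_A fst_conv snd_conv)
qed

section \<open>Approximate solutions compared with the next iterates\<close>

lemma y_near: "(\<lambda>k. y k - x (Suc k)) \<longlonglongrightarrow> 0"
proof -
  obtain c where c: "c > 0" "\<And>k. c \<le> S (x k)" using S_lower_bound by blast
  obtain C where C: "\<And>k. norm (x (Suc k) - d) \<le> C"
    using bounded_range_compose[OF bounded_x continuous_on_diff[OF continuous_on_id continuous_on_const], of d]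
    unfolding bounded_iff by blast
  \<comment> \<open>The uniform bound \<open>c\<close> on \<open>S (x k)\<close> keeps the factor in
    front of \<open>\<epsilon> k\<close> bounded.\<close>
  have "norm (y k - x (Suc k)) \<le> \<epsilon> k * (1 / sqrt c * C)" for k
  proof -
    have "norm (y k - x (Suc k)) \<le> \<epsilon> k / sqrt (S (x k)) * norm (x (Suc k) - d)"
      unfolding next_iterate
      by (rule IR_P_feasible_and_close(2)[OF S_x_pos near_ball[OF S_x_pos] eps_pos])
    also have "\<dots> \<le> \<epsilon> k / sqrt c * C"
      using c C[of k] eps_pos[of k] by (intro mult_mono divide_left_mono) (auto simp: less_imp_le S_x_pos)
    finally show ?thesis by simp
  qed
  moreover have "(\<lambda>k. \<epsilon> k * (1 / sqrt c * C)) \<longlonglongrightarrow> 0"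
    by (rule tendsto_mult_left_zero[OF eps_lim])
  ultimately show ?thesis by (rule Lim_null_comparison[OF always_eventually, OF allI])
qed

lemma bounded_y: "bounded (range y)"
proof -
  have "bounded (range (\<lambda>k. x (Suc k)))"
    using bounded_x by (rule bounded_subset) auto
  moreover have "bounded (range (\<lambda>k. y k - x (Suc k)))"
    using y_near by (auto intro: convergent_imp_bounded)
  ultimately have "bounded (range (\<lambda>k. x (Suc k) + (y k - x (Suc k))))"
    by (rule bounded_range_add)
  then show ?thesis by simp
qed

lemma bounded_x_minus_y: "bounded (range (\<lambda>k. x k - y k))"
  using bounded_range_compose[OF bounded_range_Pair[OF bounded_x bounded_y], of "\<lambda>p. fst p - snd p"]
  by (simp add: continuous_on_diff continuous_on_fst continuous_on_snd continuous_on_id)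

text \<open>Replaces the next iterate in \<open>wnorm_gap_null\<close> by \<open>y k\<close>, where
  the subgradient is taken; the weights are bounded and the two points merge.\<close>

lemma wnorm_x_y_null: "(\<lambda>k. wnorm k (x k) - wnorm k (y k)) \<longlonglongrightarrow> 0"
proof -
  have "(\<lambda>k. \<Sum>i\<in>UNIV. w (x k) $ i * (\<bar>x (Suc k) $ i\<bar> - \<bar>y k $ i\<bar>)) \<longlonglongrightarrow> 0"
  proof (rule tendsto_null_sum)
    fix i
    have "bounded (range (\<lambda>k. w (x k) $ i))"
      by (rule bounded_range_compose[OF bounded_x continuous_on_component[OF continuous_on_w]])
    moreover have "(\<lambda>k. \<bar>x (Suc k) $ i\<bar> - \<bar>y k $ i\<bar>) \<longlonglongrightarrow> 0"
    proof (rule Lim_null_comparison[OF always_eventually])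
      show "\<forall>k. norm (\<bar>x (Suc k) $ i\<bar> - \<bar>y k $ i\<bar>) \<le> \<bar>(y k - x (Suc k)) $ i\<bar>"
        by auto
      show "(\<lambda>k. \<bar>(y k - x (Suc k)) $ i\<bar>) \<longlonglongrightarrow> 0"
        using tendsto_vec_nth[OF y_near, of i] by (intro tendsto_rabs_zero) simp
    qed
    ultimately show "(\<lambda>k. w (x k) $ i * (\<bar>x (Suc k) $ i\<bar> - \<bar>y k $ i\<bar>)) \<longlonglongrightarrow> 0"
      by (rule bounded_range_mult_null)
  qed
  then have "(\<lambda>k. wnorm k (x (Suc k)) - wnorm k (y k)) \<longlonglongrightarrow> 0"
    by (simp only: right_diff_distrib sum_subtractf)
  from tendsto_add[OF wnorm_gap_null this] show ?thesis by simp
qed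

text \<open>By (A3) the origin is infeasible, so the iterates stay at a positive distance from it,
  and \<open>y k\<close> is close to \<open>x (Suc k)\<close>.\<close>

lemma y_eventually_nonzero: "\<forall>\<^sub>F k in sequentially. y k \<noteq> 0"
proof -
  have "\<not> F 0 \<le> \<sigma>"
    using A3 by (simp add: cond_A3_def F_eq)
  then have "z \<noteq> 0" if "z \<in> closure (range x)" for z
    using closure_x_feasible[OF that] by auto
  then obtain c where c: "c > 0" "\<And>k. c \<le> norm (x k)"
    using positive_lower_bound[of norm] by (auto intro: continuous_intros)
  have "\<forall>\<^sub>F k in sequentially. norm (y k - x (Suc k)) < c"
    using order_tendstoD(2)[OF tendsto_norm_zero[OF y_near] c(1)] .
  then show ?thesis
  proof eventually_elim
    case (elim k)
    then show ?case using c(2)[of "Suc k"] by auto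
  qed
qed

end

section \<open>Multipliers\<close>

text \<open>The vector \<open>s k\<close> is the subgradient of the l1 norm at \<open>y k\<close>
  behind the multiplier relation, recorded in its entrywise form \<open>s_le\<close>,
  \<open>s_mult\<close>.\<close>

locale ir_multipliers = ir_run \<psi> \<phi> A b \<sigma> \<mu> \<epsilon> x y u
  for \<psi> \<phi> :: "real \<Rightarrow> real" and A :: "real ^ 'n ^ 'm" and b :: "real ^ 'm" and \<sigma> :: real
    and \<mu> \<epsilon> :: "nat \<Rightarrow> real" and x y :: "nat \<Rightarrow> real ^ 'n" and u :: "nat \<Rightarrow> real ^ 'm" +
  fixes \<xi> s :: "nat \<Rightarrow> real ^ 'n" and l :: "nat \<Rightarrow> real"
  assumes xi_le: "\<And>k. norm (\<xi> k) \<le> \<epsilon> k"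
    and l_nonneg: "\<And>k. l k \<ge> 0"
    and s_le: "\<And>k i. \<bar>s k $ i\<bar> \<le> 1"
    and s_mult: "\<And>k i. s k $ i * y k $ i = \<bar>y k $ i\<bar>"
    and xi_eq: "\<And>k. \<xi> k = w (x k) * s k + l k *\<^sub>R (transpose (IR_A \<phi> A b (x k)) *v u k)"
    and compl: "\<And>k. l k * ((norm (u k))\<^sup>2 - S (x k)) = 0"
begin

text \<open>Scaled by \<open>v (x k)\<close>, the residuals of \<open>x k\<close> and
  \<open>y k\<close> are \<open>p k\<close> and \<open>u k + e k\<close>, where the error
  \<open>e k\<close> is bounded by the tolerance.\<close>

abbreviation p :: "nat \<Rightarrow> real ^ 'm" where "p k \<equiv> v (x k) * res (x k)"
abbreviation e :: "nat \<Rightarrow> real ^ 'm" where "e k \<equiv> v (x k) * res (y k) - u k"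

lemma e_null: "e \<longlonglongrightarrow> 0"
  by (rule Lim_null_comparison[OF always_eventually[OF allI[OF u_near]] eps_lim])

lemma xi_null: "\<xi> \<longlonglongrightarrow> 0"
  by (rule Lim_null_comparison[OF always_eventually[OF allI[OF xi_le]] eps_lim])

lemma w_s_inner: "(w (x k) * s k) \<bullet> z = \<xi> k \<bullet> z - l k * (u k \<bullet> (v (x k) * (A *v z)))"
proof -
  have "w (x k) * s k = \<xi> k - l k *\<^sub>R (transpose (IR_A \<phi> A b (x k)) *v u k)"
    by (simp add: xi_eq)
  then show ?thesis
    by (simp only: inner_diff_left inner_scaleR_left transpose_IR_A_inner)
qed

lemma w_s_y: "(w (x k) * s k) \<bullet> y k = wnorm k (y k)"
  by (simp add: inner_vec_def mult.assoc s_mult)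

lemma w_s_x_minus_y:
  "(w (x k) * s k) \<bullet> (x k - y k) = \<xi> k \<bullet> (x k - y k) - l k * (u k \<bullet> (p k - u k - e k))"
proof -
  have "v (x k) * (A *v (x k - y k)) = p k - u k - e k"
    by (simp add: matrix_vector_mult_diff_distrib algebra_simps)
  then show ?thesis by (simp add: w_s_inner)
qed

lemma s_mult_le: "s k $ i * r \<le> \<bar>r\<bar>"
  using mult_right_mono[OF s_le[of k i], of "\<bar>r\<bar>"] by (simp add: abs_mult[symmetric])

lemma subgradient: "(w (x k) * s k) \<bullet> z \<le> wnorm k z"
  unfolding inner_vec_def
  by (intro sum_mono) (simp add: mult.assoc w_pos less_imp_le mult_left_mono s_mult_le)

text \<open>A small multiplier forces \<open>w \<circ> s\<close> to be small, which is impossible as soon as \<open>y\<close> is nonzero,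
  because then some entry of \<open>s\<close> is \<open>1\<close> or \<open>-1\<close>.\<close>

lemma l_lower_bound: obtains c where "c > 0" "\<forall>\<^sub>F k in sequentially. c \<le> l k"
proof -
  obtain a where a: "a > 0" "\<And>k i. a \<le> w (x k) $ i" using w_lower_bound by blast
  obtain C where C: "\<And>k. norm (transpose (IR_A \<phi> A b (x k)) *v u k) \<le> C"
    using bounded_IR_A_u by (auto simp: bounded_iff simp del: transpose_matrix_vector)
  define D where "D = max C 1"
  have D: "D > 0" "\<And>k. norm (transpose (IR_A \<phi> A b (x k)) *v u k) \<le> D"
    using C by (auto simp: D_def le_max_iff_disj simp del: transpose_matrix_vector)
  \<comment> \<open>Half of the lower bound \<open>a\<close> absorbs the residual
    \<open>\<xi> k\<close>; the other half is left for the multiplier term.\<close>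
  have "\<forall>\<^sub>F k in sequentially. \<epsilon> k < a / 2"
    using a by (intro order_tendstoD(2)[OF eps_lim]) simp
  with y_eventually_nonzero have "\<forall>\<^sub>F k in sequentially. a / (2 * D) \<le> l k"
  proof eventually_elim
    case (elim k)
    then obtain i where i: "y k $ i \<noteq> 0" by (auto simp: vec_eq_iff)
    with s_mult[of k i] have "\<bar>s k $ i\<bar> = 1"
      by (metis abs_mult abs_abs mult_cancel_right1 abs_eq_0)
    then have "a \<le> \<bar>(w (x k) * s k) $ i\<bar>"
      using a(2)[of k i] by (simp add: abs_mult)
    also have "\<dots> \<le> norm (w (x k) * s k)" by (rule component_le_norm_cart)
    also have "\<dots> = norm (\<xi> k - l k *\<^sub>R (transpose (IR_A \<phi> A b (x k)) *v u k))"
      by (simp add: xi_eq)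
    also have "\<dots> \<le> norm (\<xi> k) + l k * norm (transpose (IR_A \<phi> A b (x k)) *v u k)"
      using norm_triangle_ineq4[of "\<xi> k" "l k *\<^sub>R (transpose (IR_A \<phi> A b (x k)) *v u k)"] l_nonneg[of k]
      by (simp del: transpose_matrix_vector)
    also have "\<dots> \<le> \<epsilon> k + l k * D"
      by (intro add_mono xi_le mult_left_mono D l_nonneg)
    finally have "a / 2 \<le> l k * D" using elim by simp
    then show ?case using D(1) by (simp add: field_simps)
  qed
  then show ?thesis using a D by (intro that[of "a / (2 * D)"]) auto
qed

lemma liminf_l_pos: "liminf (\<lambda>k. ereal (l k)) > 0"
proof -
  obtain c where c: "c > 0" "\<forall>\<^sub>F k in sequentially. c \<le> l k" using l_lower_bound by blast
  have "ereal c \<le> liminf (\<lambda>k. ereal (l k))"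
    using c(2) by (intro Liminf_bounded) (auto elim: eventually_mono)
  with c(1) show ?thesis by (metis ereal_less(2) less_le_trans)
qed

text \<open>The subgradient inequality at \<open>x k\<close>, with complementarity used to replace
  \<open>l * norm u ^ 2\<close> by \<open>l * S\<close>, bounds \<open>l / 2 * norm (p - u) ^ 2\<close> by null sequences, except for
  \<open>l * (u \<bullet> e)\<close>. Since no upper bound on \<open>l\<close> is known yet, one divides by \<open>l\<close> first.\<close>

lemma p_minus_u_null: "(\<lambda>k. p k - u k) \<longlonglongrightarrow> 0"
proof -
  obtain c where c: "c > 0" "\<forall>\<^sub>F k in sequentially. c \<le> l k" using l_lower_bound by blast
  define \<delta> where "\<delta> k = wnorm k (x k) - wnorm k (y k) - \<xi> k \<bullet> (x k - y k)" for k
  have "(\<lambda>k. (x k - y k) \<bullet> \<xi> k) \<longlonglongrightarrow> 0"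
    by (rule bounded_range_inner_null[OF bounded_x_minus_y xi_null])
  from tendsto_diff[OF wnorm_x_y_null this] have \<delta>: "\<delta> \<longlonglongrightarrow> 0"
    by (simp add: \<delta>_def[abs_def] inner_commute)
  have "\<forall>\<^sub>F k in sequentially. norm ((norm (p k - u k))\<^sup>2) \<le> 2 * (\<bar>\<delta> k\<bar> / c + \<bar>u k \<bullet> e k\<bar>)"
    using c(2)
  proof eventually_elim
    case (elim k)
    let ?q = "(norm (p k - u k))\<^sup>2 / 2 + u k \<bullet> e k"
    have "- (l k * (u k \<bullet> (p k - u k - e k))) \<le> \<delta> k"
      using subgradient[of k "x k"] w_s_x_minus_y[of k] w_s_y[of k]
      by (simp add: \<delta>_def inner_diff_right)
    \<comment> \<open>Polarization splits off the square to be bounded; the difference of squares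
      that remains has a favourable sign after multiplication by \<open>l k\<close>.\<close>
    moreover have "u k \<bullet> (p k - u k - e k)
        = ((norm (p k))\<^sup>2 - (norm (u k))\<^sup>2) / 2 - ?q"
    proof -
      have "U \<bullet> (P - U - E) = ((norm P)\<^sup>2 - (norm U)\<^sup>2) / 2 - ((norm (P - U))\<^sup>2 / 2 + U \<bullet> E)"
        for P U E :: "real ^ 'm"
        by (simp add: power2_norm_eq_inner inner_diff inner_add inner_commute field_simps)
      then show ?thesis .
    qed
    moreover have "l k * ((norm (p k))\<^sup>2 - (norm (u k))\<^sup>2) \<le> 0"
    proof -
      have "l k * ((norm (p k))\<^sup>2 - (norm (u k))\<^sup>2)
          = l k * (F (x k) - \<sigma>) - l k * ((norm (u k))\<^sup>2 - S (x k))"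
        by (simp only: S_eq right_diff_distrib distrib_left)
      moreover have "l k * (F (x k) - \<sigma>) \<le> 0"
        using l_nonneg[of k] feasible[of k] by (intro mult_nonneg_nonpos) auto
      ultimately show ?thesis using compl[of k] by linarith
    qed
    moreover have "L * q \<le> D" if "- (L * c) \<le> D" "c = a / 2 - q" "L * a \<le> 0" for L c a q D :: real
      using that by (simp add: right_diff_distrib)
    ultimately have "l k * ?q \<le> \<delta> k" by blast
    have "?q \<le> \<bar>\<delta> k\<bar> / c"
    \<comment> \<open>The lower bound \<open>c \<le> l k\<close> can be multiplied by
      \<open>?q\<close> only when \<open>?q\<close> is nonnegative.\<close>
    proof (cases "?q \<le> 0")
      case True
      then show ?thesis using c(1) by (meson abs_ge_zero divide_nonneg_pos order_trans)
    next
      case False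
      then have "c * ?q \<le> l k * ?q" using elim by (intro mult_right_mono) auto
      also have "\<dots> \<le> \<bar>\<delta> k\<bar>" using \<open>l k * ?q \<le> \<delta> k\<close> by linarith
      finally show ?thesis using c(1) by (simp only: pos_le_divide_eq mult.commute)
    qed
    then show ?case by simp
  qed
  moreover
  have "(\<lambda>k. 2 * (\<bar>\<delta> k\<bar> / c + \<bar>u k \<bullet> e k\<bar>)) \<longlonglongrightarrow> 2 * (0 / c + 0)"
    using c(1) by (intro tendsto_intros tendsto_rabs_zero \<delta> bounded_range_inner_null[OF bounded_u e_null]) auto
  then have "(\<lambda>k. 2 * (\<bar>\<delta> k\<bar> / c + \<bar>u k \<bullet> e k\<bar>)) \<longlonglongrightarrow> 0" by simp
  ultimately have "(\<lambda>k. (norm (p k - u k))\<^sup>2) \<longlonglongrightarrow> 0"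
    by (rule Lim_null_comparison)
  then show ?thesis by (rule tendsto_0_if_square)
qed

section \<open>Vanishing residual steps and the active constraint\<close>

lemma residual_step_null:
  "(\<lambda>k. right_deriv \<phi> ((b $ i - row i A \<bullet> x k)\<^sup>2) * (row i A \<bullet> (y k - x k))) \<longlonglongrightarrow> 0"
proof -
  \<comment> \<open>The terms \<open>u k\<close> cancel, leaving the residual step scaled once by
    \<open>v (x k)\<close>; a second, bounded factor \<open>v (x k) $ i\<close> turns the scaling
    into the slope of \<open>\<phi>\<close>.\<close>
  have "(\<lambda>k. e k - (p k - u k)) \<longlonglongrightarrow> 0"
    using tendsto_diff[OF e_null p_minus_u_null] by simp
  then have "(\<lambda>k. (e k - (p k - u k)) $ i) \<longlonglongrightarrow> 0"
    using tendsto_vec_nth by fastforce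
  moreover have "bounded (range (\<lambda>k. v (x k) $ i))"
    by (rule bounded_range_compose[OF bounded_x continuous_on_component[OF continuous_on_v]])
  ultimately have "(\<lambda>k. v (x k) $ i * (e k - (p k - u k)) $ i) \<longlonglongrightarrow> 0"
    by (intro bounded_range_mult_null)
  moreover have "v (x k) $ i * (e k - (p k - u k)) $ i
      = right_deriv \<phi> ((b $ i - row i A \<bullet> x k)\<^sup>2) * (row i A \<bullet> (y k - x k))" for k
  proof -
    have A: "(A *v z) $ i = row i A \<bullet> z" for z
      by (simp add: matrix_vector_mul_component row_def)
    have "v (x k) $ i * (e k - (p k - u k)) $ i = (v (x k) $ i)\<^sup>2 * ((A *v y k) $ i - (A *v x k) $ i)"
      by (simp add: power2_eq_square algebra_simps)
    then show ?thesis
      by (simp add: v_sq A inner_diff_right power2_commute)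
  qed
  ultimately show ?thesis by simp
qed

text \<open>Multipliers are eventually positive, so complementarity gives
  \<open>(norm (u k))^2 = S (x k)\<close>. Then \<open>F (x k) - \<sigma>\<close> is the difference
  of the squared norms of \<open>p k\<close> and \<open>u k\<close>, with the null factor
  \<open>p k - u k\<close>.\<close>

lemma constraint_lim: "(\<lambda>k. F (x k)) \<longlonglongrightarrow> \<sigma>"
proof -
  obtain c where c: "c > 0" "\<forall>\<^sub>F k in sequentially. c \<le> l k" using l_lower_bound by blast
  have "bounded (range p)"
    by (rule bounded_range_compose[OF bounded_x continuous_on_scaled_res])
  then have "bounded (range (\<lambda>k. p k + u k))"
    using bounded_u by (rule bounded_range_add)
  then have "(\<lambda>k. (p k + u k) \<bullet> (p k - u k)) \<longlonglongrightarrow> 0"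
    by (rule bounded_range_inner_null) (rule p_minus_u_null)
  moreover have "\<forall>\<^sub>F k in sequentially. (p k + u k) \<bullet> (p k - u k) = F (x k) - \<sigma>"
    using c(2)
  proof eventually_elim
    case (elim k)
    with c(1) compl[of k] have "(norm (u k))\<^sup>2 = S (x k)" by auto
    moreover have "(P + U) \<bullet> (P - U) = (norm P)\<^sup>2 - (norm U)\<^sup>2" for P U :: "real ^ 'm"
      by (simp add: power2_norm_eq_inner inner_diff inner_add inner_commute)
    ultimately show ?case by (simp only: S_eq)
  qed
  ultimately have "(\<lambda>k. F (x k) - \<sigma>) \<longlonglongrightarrow> 0"
    by (rule Lim_transform_eventually)
  then show ?thesis by (simp add: LIM_zero_iff)
qed

lemma accumulation_point_active:
  assumes "accumulation_point x z"
  shows "F z = \<sigma>"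
proof -
  obtain r where r: "strict_mono r" "(x \<circ> r) \<longlonglongrightarrow> z"
    using assms by (auto simp: accumulation_point_def)
  have "(F \<circ> (x \<circ> r)) \<longlonglongrightarrow> F z"
    using continuous_on_F r(2) by (simp add: continuous_on_eq_continuous_at continuous_at_sequentially)
  moreover have "((\<lambda>k. F (x k)) \<circ> r) \<longlonglongrightarrow> \<sigma>"
    by (rule LIMSEQ_subseq_LIMSEQ[OF constraint_lim r(1)])
  ultimately show ?thesis
    by (intro LIMSEQ_unique) (auto simp: o_def)
qed

lemma bounded_s: "bounded (range s)"
proof -
  have "norm (s k) \<le> (\<Sum>i\<in>(UNIV :: 'n set). 1)" for k
    using norm_le_l1_cart[of "s k"] s_le by (meson order_trans sum_mono)
  then show ?thesis by (auto intro: boundedI)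
qed

text \<open>Testing the stationarity relation with \<open>y - d\<close>, where \<open>d\<close> solves \<open>A d = b\<close>, isolates
  \<open>l * (norm u ^ 2 + u \<bullet> e)\<close>.\<close>

lemma bounded_l: "bounded (range l)"
proof -
  obtain c where c: "c > 0" "\<And>k. c \<le> S (x k)" using S_lower_bound by blast
  obtain Y where Y: "\<And>k. norm (y k - d) \<le> Y"
    using bounded_range_compose[OF bounded_y continuous_on_diff[OF continuous_on_id continuous_on_const], of d]
    unfolding bounded_iff by blast
  obtain W where W: "\<And>k. norm (w (x k)) \<le> W" using bounded_w by (auto simp: bounded_iff)
  obtain T where T: "\<And>k. norm (s k) \<le> T" using bounded_s by (auto simp: bounded_iff)
  obtain X where X: "\<And>k. norm (\<xi> k) \<le> X"
    using convergent_imp_bounded[OF xi_null] by (auto simp: bounded_iff)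
  have "W \<ge> 0" using W order_trans[OF norm_ge_zero] by blast
  have "X \<ge> 0" using X order_trans[OF norm_ge_zero] by blast
  have "T \<ge> 0" using T order_trans[OF norm_ge_zero] by blast
  define C where "C = (X + W * T) * Y"
  have C: "(\<xi> k - w (x k) * s k) \<bullet> (y k - d) \<le> C" for k
  proof -
    have "(\<xi> k - w (x k) * s k) \<bullet> (y k - d) \<le> norm (\<xi> k - w (x k) * s k) * norm (y k - d)"
      by (rule norm_cauchy_schwarz)
    also have "\<dots> \<le> (norm (\<xi> k) + norm (w (x k)) * norm (s k)) * norm (y k - d)"
      by (intro mult_right_mono order_trans[OF norm_triangle_ineq4] add_left_mono norm_vec_times_le) simp
    also have "\<dots> \<le> C"
      unfolding C_def using \<open>W \<ge> 0\<close> \<open>X \<ge> 0\<close> \<open>T \<ge> 0\<close> by (intro mult_mono add_mono W T X Y) auto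
    finally show ?thesis .
  qed
  have "(\<lambda>k. u k \<bullet> e k) \<longlonglongrightarrow> 0" by (rule bounded_range_inner_null[OF bounded_u e_null])
  \<comment> \<open>The error may use up half of \<open>c \<le> S (x k)\<close>; the remaining half
    gives the bound \<open>2 * C / c\<close>.\<close>
  then have "\<forall>\<^sub>F k in sequentially. - c / 2 < u k \<bullet> e k"
    using c by (intro order_tendstoD(1)) auto
  then have "\<forall>\<^sub>F k in sequentially. norm (l k) \<le> 2 * C / c"
  proof eventually_elim
    case (elim k)
    have "v (x k) * (A *v (y k - d)) = u k + e k"
      by (simp add: matrix_vector_mult_diff_distrib A_d)
    then have "l k * (u k \<bullet> (u k + e k)) = (\<xi> k - w (x k) * s k) \<bullet> (y k - d)"
      using w_s_inner[of k "y k - d"] by (simp add: inner_diff_left)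
    also have "\<dots> \<le> C" by (rule C)
    finally have "l k * (norm (u k))\<^sup>2 + l k * (u k \<bullet> e k) \<le> C"
      by (simp only: inner_add_right power2_norm_eq_inner distrib_left)
    moreover have "l k * (norm (u k))\<^sup>2 = l k * S (x k)"
      using compl[of k] by (simp only: right_diff_distrib)
    moreover have "l k * S (x k) \<ge> l k * c" by (intro mult_left_mono c l_nonneg)
    moreover have "l k * (u k \<bullet> e k) \<ge> l k * (- c / 2)"
      using elim l_nonneg[of k] by (intro mult_left_mono) auto
    ultimately have "l k * c \<le> 2 * C" by simp
    then show ?case using c(1) l_nonneg[of k] by (simp add: pos_le_divide_eq)
  qed
  then show ?thesis by (rule eventually_bounded_imp_bounded_range)
qed

text \<open>Hence limits of \<open>s\<close> along \<open>x k \<longrightarrow> z\<close> are subgradients at \<open>z\<close>, even though \<open>y k\<close>, where \<open>s k\<close> is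
  a subgradient, need not converge to \<open>z\<close>.\<close>

lemma s_almost_subgradient: "(\<lambda>k. \<bar>x k $ i\<bar> - s k $ i * x k $ i) \<longlonglongrightarrow> 0"
proof -
  obtain a where a: "a > 0" "\<And>k i. a \<le> w (x k) $ i" using w_lower_bound by blast
  \<comment> \<open>This is the total gap in the subgradient inequality at \<open>x k\<close>. By
    \<open>D_eq\<close> it is a sum of nonnegative terms with weights at least \<open>a\<close>, so
    each term vanishes with \<open>D\<close>.\<close>
  define D where "D k = wnorm k (x k) - wnorm k (y k) - \<xi> k \<bullet> (x k - y k)
    + l k * (u k \<bullet> (p k - u k - e k))" for k
  have D_eq: "D k = (\<Sum>i\<in>UNIV. w (x k) $ i * (\<bar>x k $ i\<bar> - s k $ i * x k $ i))" for k
  proof -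
    have "D k = wnorm k (x k) - (w (x k) * s k) \<bullet> x k"
      using w_s_x_minus_y[of k] w_s_y[of k] by (simp add: D_def inner_diff_right)
    then show ?thesis
      by (simp add: inner_vec_def right_diff_distrib sum_subtractf mult.assoc)
  qed
  have "(\<lambda>k. (x k - y k) \<bullet> \<xi> k) \<longlonglongrightarrow> 0"
    by (rule bounded_range_inner_null[OF bounded_x_minus_y xi_null])
  moreover have "(\<lambda>k. l k * (u k \<bullet> (p k - u k - e k))) \<longlonglongrightarrow> 0"
    using tendsto_diff[OF p_minus_u_null e_null]
    by (intro bounded_range_mult_null[OF bounded_l] bounded_range_inner_null[OF bounded_u]) simp
  ultimately have "(\<lambda>k. (wnorm k (x k) - wnorm k (y k)) - (x k - y k) \<bullet> \<xi> k
      + l k * (u k \<bullet> (p k - u k - e k))) \<longlonglongrightarrow> 0 - 0 + 0"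
    by (intro tendsto_add tendsto_diff wnorm_x_y_null)
  then have "D \<longlonglongrightarrow> 0" by (simp add: D_def[abs_def] inner_commute)
  then have "(\<lambda>k. D k / a) \<longlonglongrightarrow> 0" by (rule tendsto_divide_zero)
  moreover have "norm (\<bar>x k $ i\<bar> - s k $ i * x k $ i) \<le> D k / a" for k
  proof -
    have nn: "0 \<le> \<bar>x k $ j\<bar> - s k $ j * x k $ j" for j using s_mult_le[of k j "x k $ j"] by simp
    have "a * (\<bar>x k $ i\<bar> - s k $ i * x k $ i) \<le> w (x k) $ i * (\<bar>x k $ i\<bar> - s k $ i * x k $ i)"
      by (intro mult_right_mono a nn)
    also have "\<dots> \<le> D k"
      unfolding D_eq by (rule member_le_sum) (auto intro!: mult_nonneg_nonneg nn less_imp_le[OF w_pos])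
    finally show ?thesis using a(1) nn[of i] by (simp add: pos_le_divide_eq mult.commute)
  qed
  ultimately show ?thesis
    by (rule Lim_null_comparison[OF always_eventually, OF allI, rotated])
qed

text \<open>On a further subsequence \<open>l\<close> and \<open>s\<close> converge as well, and
  \<open>p - u\<close> tending to \<open>0\<close> identifies the limit of \<open>u\<close>. The
  limit of \<open>xi_eq\<close> is then the stationarity equation.\<close>

lemma accumulation_point_stationary:
  assumes "accumulation_point x z"
  shows "stationary_point \<psi> \<phi> A b \<sigma> z"
proof -
  obtain r1 where r1: "strict_mono r1" "(x \<circ> r1) \<longlonglongrightarrow> z"
    using assms by (auto simp: accumulation_point_def)
  have "bounded (range (\<lambda>k. (l (r1 k), s (r1 k))))"
    using bounded_range_Pair[OF bounded_l bounded_s] by (rule bounded_subset) auto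
  then obtain ls r2 where r2: "strict_mono r2" "((\<lambda>k. (l (r1 k), s (r1 k))) \<circ> r2) \<longlonglongrightarrow> ls"
    using bounded_imp_convergent_subsequence by blast
  obtain l' s' where ls: "ls = (l', s')" by (cases ls)
  define r where "r = r1 \<circ> r2"
  have r: "strict_mono r" unfolding r_def by (intro strict_mono_o r1 r2)
  have xr: "(\<lambda>k. x (r k)) \<longlonglongrightarrow> z"
    using LIMSEQ_subseq_LIMSEQ[OF r1(2) r2(1)] by (simp add: r_def o_def)
  have lr: "(\<lambda>k. l (r k)) \<longlonglongrightarrow> l'" and sr: "(\<lambda>k. s (r k)) \<longlonglongrightarrow> s'"
    using tendsto_fst[OF r2(2)] tendsto_snd[OF r2(2)] by (simp_all add: r_def o_def ls)
  have cont: "(\<lambda>k. G (x (r k))) \<longlonglongrightarrow> G z" if "continuous_on UNIV G" for G :: "_ \<Rightarrow> 'z::topological_space"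
    using that xr by (rule continuous_on_tendsto_compose) auto
  have sub: "(\<lambda>k. X (r k)) \<longlonglongrightarrow> 0" if "X \<longlonglongrightarrow> 0" for X :: "nat \<Rightarrow> 'z::real_normed_vector"
    using LIMSEQ_subseq_LIMSEQ[OF that r] by (simp add: o_def)
  have "(\<lambda>k. p (r k) - (p (r k) - u (r k))) \<longlonglongrightarrow> v z * res z - 0"
    by (intro tendsto_diff cont[OF continuous_on_scaled_res] sub[OF p_minus_u_null])
  then have ur: "(\<lambda>k. u (r k)) \<longlonglongrightarrow> v z * res z" by simp
  have "(\<lambda>k. transpose A *v (v (x (r k)) * u (r k))) \<longlonglongrightarrow> transpose A *v (v z * (v z * res z))"
    by (intro bounded_linear.tendsto[OF matrix_vector_mul_bounded_linear] tendsto_vec_times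
        cont[OF continuous_on_v] ur)
  then have "(\<lambda>k. \<xi> (r k)) \<longlonglongrightarrow> w z * s' + l' *\<^sub>R (transpose A *v (v z * (v z * res z)))"
    unfolding xi_eq transpose_IR_A
    by (intro tendsto_add tendsto_scaleR tendsto_vec_times cont[OF continuous_on_w] sr lr)
  from LIMSEQ_unique[OF this sub[OF xi_null]]
  have eq: "w z * s' + l' *\<^sub>R (transpose A *v (v z * (v z * res z))) = 0" .
  have row: "transpose A *v q = (\<Sum>i\<in>UNIV. q $ i *\<^sub>R row i A)" for q
    by (simp add: matrix_vector_mult_def vec_eq_iff transpose_def row_def mult.commute
        del: transpose_matrix_vector)
  have A: "(A *v z) $ i = row i A \<bullet> z" for i
    by (simp add: matrix_vector_mul_component row_def)
  \<comment> \<open>The two factors \<open>v z\<close> combine to the slope of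
    \<open>\<phi>\<close>; the sign appears because \<open>res z\<close> is
    \<open>A *v z - b\<close>.\<close>
  have coeff: "(v z * (v z * res z)) $ i
      = - (right_deriv \<phi> ((b $ i - row i A \<bullet> z)\<^sup>2) * (b $ i - row i A \<bullet> z))" for i
  proof -
    have "(v z * (v z * res z)) $ i = (v z $ i)\<^sup>2 * (res z $ i)"
      by (simp only: vector_mult_component power2_eq_square mult.assoc)
    also have "\<dots> = right_deriv \<phi> ((row i A \<bullet> z - b $ i)\<^sup>2) * (row i A \<bullet> z - b $ i)"
      by (simp only: v_sq vector_minus_component A)
    finally show ?thesis
      by (simp only: power2_commute[of "row i A \<bullet> z"]) (simp only: mult_minus_right[symmetric] minus_diff_eq)
  qed
  have "transpose A *v (v z * (v z * res z)) = - (\<Sum>i\<in>UNIV.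
      (right_deriv \<phi> ((b $ i - row i A \<bullet> z)\<^sup>2) * (b $ i - row i A \<bullet> z)) *\<^sub>R row i A)"
    unfolding row coeff by (simp add: sum_negf)
  \<comment> \<open>Stationarity carries a factor \<open>2\<close> in front of its multiplier, so
    the witness is half the limit of \<open>l\<close>.\<close>
  with eq have "0 = w z * s' + - ((2 * (l' / 2)) *\<^sub>R (\<Sum>i\<in>UNIV.
      (right_deriv \<phi> ((b $ i - row i A \<bullet> z)\<^sup>2) * (b $ i - row i A \<bullet> z)) *\<^sub>R row i A))"
    by (simp del: transpose_matrix_vector)
  moreover have "s' \<in> subdifferential l1_norm z"
    unfolding subdifferential_l1_norm
  proof (intro CollectI allI conjI)
    fix i
    have si: "(\<lambda>k. s (r k) $ i) \<longlonglongrightarrow> s' $ i" and xi: "(\<lambda>k. x (r k) $ i) \<longlonglongrightarrow> z $ i"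
      using sr xr by (auto intro: tendsto_vec_nth)
    show "\<bar>s' $ i\<bar> \<le> 1"
      by (rule tendsto_upperbound[OF tendsto_rabs[OF si]]) (auto simp: s_le)
    have "(\<lambda>k. \<bar>x (r k) $ i\<bar> - s (r k) $ i * x (r k) $ i) \<longlonglongrightarrow> \<bar>z $ i\<bar> - s' $ i * z $ i"
      by (intro tendsto_diff tendsto_rabs tendsto_mult si xi)
    from LIMSEQ_unique[OF this sub[OF s_almost_subgradient]]
    show "s' $ i * z $ i = \<bar>z $ i\<bar>" by simp
  qed
  ultimately have "0 \<in> (\<lambda>s. w z * s) ` subdifferential l1_norm z
      + {- ((2 * (l' / 2)) *\<^sub>R (\<Sum>i\<in>UNIV.
          (right_deriv \<phi> ((b $ i - row i A \<bullet> z)\<^sup>2) * (b $ i - row i A \<bullet> z)) *\<^sub>R row i A))}"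
    unfolding set_plus_def by blast
  moreover have "l' / 2 \<ge> 0"
    using LIMSEQ_le_const[OF lr, of 0] l_nonneg by simp
  moreover have "F z = \<sigma>" by (rule accumulation_point_active[OF assms])
  ultimately show ?thesis
    unfolding stationary_point_def IR_w_def by (intro exI[of _ "l' / 2"]) simp
qed

end

section \<open>From the algorithm to the abstract run, and the result\<close>

lemma ir_runI:
  fixes A :: "real ^ 'n ^ 'm"
  assumes "cond_A1 \<psi>" "cond_A2 \<phi>" "cond_A3 \<phi> A b \<sigma>" "cond_A4 \<phi> \<sigma> CARD('m)"
    and run: "IR_sequence \<psi> \<phi> A b \<sigma> \<tau> \<mu> \<epsilon> x xt ut"
  shows "ir_run \<psi> \<phi> A b \<sigma> \<mu> \<epsilon> x (\<lambda>k. xt (Suc k)) (\<lambda>k. ut (Suc k))"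
proof -
  interpret ir_problem \<psi> \<phi> A b \<sigma> using assms by unfold_locales
  have eps: "0 < \<epsilon> k" "\<epsilon> k \<le> \<tau> k" for k
    using run by (auto simp: IR_sequence_def)
  have "\<tau> \<longlonglongrightarrow> 0" using run by (simp add: IR_sequence_def)
  then have "\<epsilon> \<longlonglongrightarrow> 0"
    by (rule Lim_null_comparison[rotated]) (use eps in \<open>auto simp: abs_of_pos\<close>)
  with eps show ?thesis
    using run by unfold_locales (auto simp: IR_sequence_def feasible_set_def)
qed

theorem theorem3p1:
  fixes A :: "real ^ 'n ^ 'm" and b :: "real ^ 'm" and \<sigma> :: real
    and \<psi> \<phi> :: "real \<Rightarrow> real"
    and \<tau> \<mu> \<epsilon> :: "nat \<Rightarrow> real"
    and x xt :: "nat \<Rightarrow> real ^ 'n" and ut :: "nat \<Rightarrow> real ^ 'm"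
  assumes "cond_A1 \<psi>" and "cond_A2 \<phi>" and "cond_A3 \<phi> A b \<sigma>" and "cond_A4 \<phi> \<sigma> CARD('m)"
    and "IR_sequence \<psi> \<phi> A b \<sigma> \<tau> \<mu> \<epsilon> x xt ut"
  shows
    "(\<forall>k. \<exists>\<xi> l. IR_multiplier \<psi> \<phi> A b \<sigma> (\<epsilon> k) (x k) (xt (Suc k)) (ut (Suc k)) \<xi> l) \<and>
     (\<forall>\<xi> l. (\<forall>k. IR_multiplier \<psi> \<phi> A b \<sigma> (\<epsilon> k) (x k) (xt (Suc k)) (ut (Suc k)) (\<xi> k) (l k)) \<longrightarrow>
        liminf (\<lambda>k. ereal (l k)) > 0 \<and>
        (\<forall>i. (\<lambda>k. right_deriv \<phi> ((b $ i - row i A \<bullet> x k)\<^sup>2) * (row i A \<bullet> (xt (Suc k) - x k)))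
               \<longlonglongrightarrow> 0) \<and>
        (\<forall>p. accumulation_point x p \<longrightarrow> constraint_fun \<phi> A b p = \<sigma>) \<and>
        bounded (range l) \<and>
        (\<forall>p. accumulation_point x p \<longrightarrow> stationary_point \<psi> \<phi> A b \<sigma> p))"
proof -
  interpret run: ir_run \<psi> \<phi> A b \<sigma> \<mu> \<epsilon> x "\<lambda>k. xt (Suc k)" "\<lambda>k. ut (Suc k)"
    by (rule ir_runI[OF assms])
  show ?thesis
  proof (intro conjI allI impI)
    show "\<exists>\<xi> l. IR_multiplier \<psi> \<phi> A b \<sigma> (\<epsilon> k) (x k) (xt (Suc k)) (ut (Suc k)) \<xi> l" for k
      by (rule run.IR_multiplier_exists[OF run.step run.S_x_pos])
  next
    fix \<xi> l
    assume mult: "\<forall>k. IR_multiplier \<psi> \<phi> A b \<sigma> (\<epsilon> k) (x k) (xt (Suc k)) (ut (Suc k)) (\<xi> k) (l k)"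
    \<comment> \<open>The set sum hides the subgradient; one is chosen for each \<open>k\<close> to
      serve as the sequence \<open>s\<close>.\<close>
    then have "\<forall>k. \<exists>s\<in>subdifferential l1_norm (xt (Suc k)).
        \<xi> k = IR_w \<psi> (x k) * s + l k *\<^sub>R (transpose (IR_A \<phi> A b (x k)) *v ut (Suc k))"
      unfolding IR_multiplier_def set_plus_def by blast
    then obtain s where "\<And>k. s k \<in> subdifferential l1_norm (xt (Suc k))"
      and "\<And>k. \<xi> k = IR_w \<psi> (x k) * s k + l k *\<^sub>R (transpose (IR_A \<phi> A b (x k)) *v ut (Suc k))"
      by metis
    then interpret ir_multipliers \<psi> \<phi> A b \<sigma> \<mu> \<epsilon> x "\<lambda>k. xt (Suc k)" "\<lambda>k. ut (Suc k)" \<xi> s l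
      using mult by unfold_locales (auto simp: IR_multiplier_def subdifferential_l1_norm
          simp del: transpose_matrix_vector)
    show "liminf (\<lambda>k. ereal (l k)) > 0" by (rule liminf_l_pos)
    show "(\<lambda>k. right_deriv \<phi> ((b $ i - row i A \<bullet> x k)\<^sup>2) * (row i A \<bullet> (xt (Suc k) - x k))) \<longlonglongrightarrow> 0" for i
      by (rule residual_step_null)
    show "constraint_fun \<phi> A b p = \<sigma>" if "accumulation_point x p" for p
      using that by (rule accumulation_point_active)
    show "bounded (range l)" by (rule bounded_l)
    show "stationary_point \<psi> \<phi> A b \<sigma> p" if "accumulation_point x p" for p
      using that by (rule accumulation_point_stationary)
  qed
qed

end
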